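(* Let $\mathbf{M}=\boxplus_{c\in C}\mathbf{M}_c$ be an idempotent ordered monoid, where $\mathbf{C}=\langle C,\sqsubseteq\rangle$ is a chain, such that $\mathbf{M}_c\in\{\mathbf{C}_2,\mathbf{C}_2^\partial,\mathbf{G}_3,\mathbf{D}_3\}$ for all $c\in C$. Then the following are equivalent: (1) $\mathbf{M}$ is subdirectly irreducible. (2) $\mathbf{C}$ contains a maximal element, and for all $d_1,d_2\in C$ with $d_1\sqsubset d_2$ and $\mathbf{M}_{d_1}=\mathbf{M}_{d_2}\in\{\mathbf{C}_2,\mathbf{C}_2^\partial\}$ there exists $b\in C$ such that $d_1\sqsubset b\sqsubset d_2$ and $\mathbf{M}_b\ne\mathbf{M}_{d_1}$. (3) The congruence lattice of $\mathbf{M}$ is a chain containing an atom.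
   Context: An ordered monoid is an algebra $\langle M,\wedge,\vee,\cdot,e\rangle$ (equivalently a structure $\langle M,\cdot,e,\le\rangle$), where $\langle M,\cdot,e\rangle$ is a monoid and $\wedge,\vee$ are the minimum and maximum of a total order $\le$ such that $a\le b$ implies $cad\le cbd$ for all $a,b,c,d$. It is idempotent if $a\cdot a=a$ for all $a$. Congruences and subdirect irreducibility refer to the signature $\{\wedge,\vee,\cdot,e\}$. A chain is a totally ordered set. The four algebras are the following idempotent ordered monoids with identity $e$: $\mathbf{C}_2$ has universe $\{\bot<e\}$; $\mathbf{C}_2^\partial$ has universe $\{e<\top\}$; $\mathbf{G}_3$ has universe $\{\bot<e<\top\}$ with $\bot\cdot\top=\bot$, $\top\cdot\bot=\top$; $\mathbf{D}_3$ has universe $\{\bot<e<\top\}$ with $\bot\cdot\top=\top$, $\top\cdot\bot=\bot$. Nested sum: let $\mathbf{C}=\langle C,\sqsubseteq\rangle$ be a chain and $\{\mathbf{M}_c\}_{c\in C}$ a family of idempotent ordered monoids, relabeled so that $M_c\cap M_d=\{e\}$ for $c\ne d$. Then $\boxplus_{c\in C}\mathbf{M}_c=\langle\bigcup_{c\in C}M_c,\cdot,e,\le\rangle$, where $\cdot$ extends every $\cdot_c$ and $a\cdot b=b\cdot a=a$ whenever $c\sqsubset d$, $a\in M_c\setminus\{e\}$, $b\in M_d$; and $\le$ is the least extension of the orders $\le_c$ such that whenever $c\sqsubset d$, $a\in M_c\setminus\{e\}$, $b\in M_d$, we have $a\le b$ if $a\le_c e$, and $b\le a$ if $e\le_c a$.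 For $C=\emptyset$ it is the trivial ordered monoid. Equalities such as $\mathbf{M}_{d_1}=\mathbf{M}_{d_2}$ are equalities of members of $\{\mathbf{C}_2,\mathbf{C}_2^\partial,\mathbf{G}_3,\mathbf{D}_3\}$ (before relabeling). *)

theory Defs
  imports "HOL-Algebra.Group"
begin

section \<open>Algebras in the signature of ordered monoids\<close>

record 'a om_algebra = "'a monoid" +
  minop :: "'a \<Rightarrow> 'a \<Rightarrow> 'a"
  maxop :: "'a \<Rightarrow> 'a \<Rightarrow> 'a"

definition om_closed :: "'a om_algebra \<Rightarrow> bool" where
  "om_closed A \<longleftrightarrow> \<one>\<^bsub>A\<^esub> \<in> carrier A \<and>
     (\<forall>a\<in>carrier A. \<forall>b\<in>carrier A.
        a \<otimes>\<^bsub>A\<^esub> b \<in> carrier A \<and> minop A a b \<in> carrier A \<and> maxop A a b \<in> carrier A)"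

definition leq :: "'a om_algebra \<Rightarrow> 'a \<Rightarrow> 'a \<Rightarrow> bool" where
  "leq A a b \<longleftrightarrow> minop A a b = a"

locale idempotent_ordered_monoid = Group.monoid A for A :: "'a om_algebra" (structure) +
  assumes linear: "linear_order_on (carrier A)
                     {(a, b). a \<in> carrier A \<and> b \<in> carrier A \<and> leq A a b}"
    and minop: "\<lbrakk>a \<in> carrier A; b \<in> carrier A\<rbrakk> \<Longrightarrow> minop A a b = (if leq A a b then a else b)"
    and maxop: "\<lbrakk>a \<in> carrier A; b \<in> carrier A\<rbrakk> \<Longrightarrow> maxop A a b = (if leq A a b then b else a)"
    and compatible: "\<lbrakk>a \<in> carrier A; b \<in> carrier A; c \<in> carrier A; d \<in> carrier A; leq A a b\<rbrakk>
                       \<Longrightarrow> leq A (c \<otimes> a \<otimes> d) (c \<otimes> b \<otimes> d)"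
    and idempotent: "a \<in> carrier A \<Longrightarrow> a \<otimes> a = a"

definition om_hom :: "'a om_algebra \<Rightarrow> 'b om_algebra \<Rightarrow> ('a \<Rightarrow> 'b) set" where
  "om_hom A B = {h \<in> hom A B. h \<one>\<^bsub>A\<^esub> = \<one>\<^bsub>B\<^esub> \<and>
     (\<forall>a\<in>carrier A. \<forall>b\<in>carrier A.
        h (minop A a b) = minop B (h a) (h b) \<and> h (maxop A a b) = maxop B (h a) (h b))}"

definition om_iso :: "'a om_algebra \<Rightarrow> 'b om_algebra \<Rightarrow> ('a \<Rightarrow> 'b) set" where
  "om_iso A B = {h \<in> om_hom A B. bij_betw h (carrier A) (carrier B)}"

definition om_product :: "'i set \<Rightarrow> ('i \<Rightarrow> 'b om_algebra) \<Rightarrow> ('i \<Rightarrow> 'b) om_algebra" where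
  "om_product I B =
     \<lparr>carrier = (\<Pi>\<^sub>E i\<in>I. carrier (B i)),
      mult = (\<lambda>f g. \<lambda>i\<in>I. f i \<otimes>\<^bsub>B i\<^esub> g i),
      one = (\<lambda>i\<in>I. \<one>\<^bsub>B i\<^esub>),
      minop = (\<lambda>f g. \<lambda>i\<in>I. minop (B i) (f i) (g i)),
      maxop = (\<lambda>f g. \<lambda>i\<in>I. maxop (B i) (f i) (g i))\<rparr>"

definition subdirect_embedding ::
  "'i set \<Rightarrow> ('i \<Rightarrow> 'b om_algebra) \<Rightarrow> 'a om_algebra \<Rightarrow> ('a \<Rightarrow> 'i \<Rightarrow> 'b) \<Rightarrow> bool" where
  "subdirect_embedding I B A h \<longleftrightarrow>
     (\<forall>i\<in>I. om_closed (B i)) \<and> h \<in> om_hom A (om_product I B) \<and> inj_on h (carrier A) \<and>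
     (\<forall>i\<in>I. (\<lambda>a. h a i) ` carrier A = carrier (B i))"

text \<open>
  Every subdirect embedding into a product contains an isomorphic projection. A definition cannot
  quantify over the types of the index set and of the factors; these are fixed here to be large
  enough for factors that are quotients of \<open>A\<close>, indexed by kernels. The lemma
  \<open>subdirectly_irreducible_any_family\<close> below shows that this is no restriction.

  The index set may be empty, so a one-element algebra is not subdirectly irreducible (it embeds
  into the empty product).
\<close>

definition subdirectly_irreducible :: "'a om_algebra \<Rightarrow> bool" where
  "subdirectly_irreducible A \<longleftrightarrow>
     (\<forall>(I :: 'a rel set) (B :: 'a rel \<Rightarrow> 'a set om_algebra) h.
        subdirect_embedding I B A h \<longrightarrow> (\<exists>i\<in>I. (\<lambda>a. h a i) \<in> om_iso A (B i)))"

definition congruence :: "'a om_algebra \<Rightarrow> 'a rel \<Rightarrow> bool" where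
  "congruence A \<theta> \<longleftrightarrow> equiv (carrier A) \<theta> \<and>
     (\<forall>a b c d. (a, b) \<in> \<theta> \<longrightarrow> (c, d) \<in> \<theta> \<longrightarrow>
        (a \<otimes>\<^bsub>A\<^esub> c, b \<otimes>\<^bsub>A\<^esub> d) \<in> \<theta> \<and>
        (minop A a c, minop A b d) \<in> \<theta> \<and>
        (maxop A a c, maxop A b d) \<in> \<theta>)"

definition Con :: "'a om_algebra \<Rightarrow> 'a rel set" where
  "Con A = {\<theta>. congruence A \<theta>}"

definition atom_of :: "'a set set \<Rightarrow> 'a set \<Rightarrow> bool" where
  "atom_of L \<alpha> \<longleftrightarrow> \<alpha> \<in> L \<and>
     (\<exists>\<beta>\<in>L. (\<forall>\<gamma>\<in>L. \<beta> \<subseteq> \<gamma>) \<and> \<beta> \<subset> \<alpha> \<and> \<not> (\<exists>\<gamma>\<in>L. \<beta> \<subset> \<gamma> \<and> \<gamma> \<subset> \<alpha>))"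


section \<open>The four components\<close>

datatype elt = Bot | E | Top

fun elt_le :: "elt \<Rightarrow> elt \<Rightarrow> bool" where
  "elt_le Bot _ = True"
| "elt_le E y = (y \<noteq> Bot)"
| "elt_le Top y = (y = Top)"

definition om_of_order :: "'a set \<Rightarrow> ('a \<Rightarrow> 'a \<Rightarrow> 'a) \<Rightarrow> 'a \<Rightarrow> ('a \<Rightarrow> 'a \<Rightarrow> bool) \<Rightarrow> 'a om_algebra" where
  "om_of_order X m u R =
     \<lparr>carrier = X, mult = m, one = u,
      minop = (\<lambda>a b. if R a b then a else b), maxop = (\<lambda>a b. if R a b then b else a)\<rparr>"

text \<open>
  On the non-identity elements, \<open>mult_left\<close> is \<open>x \<cdot> y = x\<close> and \<open>mult_right\<close> is \<open>x \<cdot> y = y\<close>.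
\<close>

definition mult_left :: "elt \<Rightarrow> elt \<Rightarrow> elt" where
  "mult_left x y = (if x = E then y else x)"

definition mult_right :: "elt \<Rightarrow> elt \<Rightarrow> elt" where
  "mult_right x y = (if y = E then x else y)"

definition C2 :: "elt om_algebra" where
  "C2 = om_of_order {Bot, E} mult_left E elt_le"

definition C2d :: "elt om_algebra" where
  "C2d = om_of_order {E, Top} mult_left E elt_le"

definition G3 :: "elt om_algebra" where
  "G3 = om_of_order {Bot, E, Top} mult_left E elt_le"

definition D3 :: "elt om_algebra" where
  "D3 = om_of_order {Bot, E, Top} mult_right E elt_le"


section \<open>Nested sums\<close>

text \<open>
  The chain is a set \<open>C\<close> with a relation \<open>r\<close> satisfying \<open>linear_order_on C r\<close>, where
  \<open>(c, d) \<in> r\<close> means \<open>c \<sqsubseteq> d\<close>. The relabelling of the components is done by the maps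
  \<open>emb M c\<close>, which send the identity of every component to the common identity \<open>None\<close>,
  and a non-identity element \<open>a\<close> of component \<open>c\<close> to \<open>Some (c, a)\<close>.
\<close>

definition emb :: "('c \<Rightarrow> 'm om_algebra) \<Rightarrow> 'c \<Rightarrow> 'm \<Rightarrow> ('c \<times> 'm) option" where
  "emb M c a = (if a = \<one>\<^bsub>M c\<^esub> then None else Some (c, a))"

definition nested_carrier :: "'c set \<Rightarrow> ('c \<Rightarrow> 'm om_algebra) \<Rightarrow> ('c \<times> 'm) option set" where
  "nested_carrier C M = {None} \<union> (\<Union>c\<in>C. emb M c ` carrier (M c))"

fun nested_mult :: "'c rel \<Rightarrow> ('c \<Rightarrow> 'm om_algebra) \<Rightarrow>
    ('c \<times> 'm) option \<Rightarrow> ('c \<times> 'm) option \<Rightarrow> ('c \<times> 'm) option" where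
  "nested_mult r M None y = y"
| "nested_mult r M (Some x) None = Some x"
| "nested_mult r M (Some (c, a)) (Some (d, b)) =
     (if c = d then emb M c (a \<otimes>\<^bsub>M c\<^esub> b)
      else if (c, d) \<in> r then Some (c, a) else Some (d, b))"

text \<open>The rule \<open>unit\<close> is only needed for the empty chain.\<close>

inductive nested_le :: "'c set \<Rightarrow> 'c rel \<Rightarrow> ('c \<Rightarrow> 'm om_algebra) \<Rightarrow>
    ('c \<times> 'm) option \<Rightarrow> ('c \<times> 'm) option \<Rightarrow> bool"
  for C :: "'c set" and r :: "'c rel" and M :: "'c \<Rightarrow> 'm om_algebra" where
  unit: "nested_le C r M None None"
| component: "\<lbrakk>c \<in> C; a \<in> carrier (M c); b \<in> carrier (M c); leq (M c) a b\<rbrakk>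
    \<Longrightarrow> nested_le C r M (emb M c a) (emb M c b)"
| below: "\<lbrakk>c \<in> C; d \<in> C; (c, d) \<in> r; c \<noteq> d; a \<in> carrier (M c) - {\<one>\<^bsub>M c\<^esub>}; b \<in> carrier (M d);
    leq (M c) a \<one>\<^bsub>M c\<^esub>\<rbrakk> \<Longrightarrow> nested_le C r M (emb M c a) (emb M d b)"
| above: "\<lbrakk>c \<in> C; d \<in> C; (c, d) \<in> r; c \<noteq> d; a \<in> carrier (M c) - {\<one>\<^bsub>M c\<^esub>}; b \<in> carrier (M d);
    leq (M c) \<one>\<^bsub>M c\<^esub> a\<rbrakk> \<Longrightarrow> nested_le C r M (emb M d b) (emb M c a)"

definition nested_sum :: "'c set \<Rightarrow> 'c rel \<Rightarrow> ('c \<Rightarrow> 'm om_algebra) \<Rightarrow> ('c \<times> 'm) option om_algebra" where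
  "nested_sum C r M =
     om_of_order (nested_carrier C M) (nested_mult r M) None (nested_le C r M)"


section \<open>Consistency of the definitions\<close>

text \<open>
  Besides the independence of subdirect irreducibility from the choice of types, the four components
  are shown to be idempotent ordered monoids, and so is every nested sum of idempotent ordered
  monoids. The latter is therefore not a hypothesis that has to be stated separately.
\<close>

lemma subdirectly_irreducible_any_family:
  fixes A :: "'a om_algebra" and I :: "'i set" and B :: "'i \<Rightarrow> 'b om_algebra"
  assumes si: "subdirectly_irreducible A" and emb: "subdirect_embedding I B A h"
    and cl: "om_closed A"
  shows "\<exists>i\<in>I. (\<lambda>a. h a i) \<in> om_iso A (B i)"
proof -
  define K where "K i = {(a, b). a \<in> carrier A \<and> b \<in> carrier A \<and> h a i = h b i}" for i
  define s where "s k = (SOME i. i \<in> I \<and> K i = k)" for k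
  have s: "s k \<in> I" "K (s k) = k" if "k \<in> K ` I" for k
    using someI_ex[of "\<lambda>i. i \<in> I \<and> K i = k"] that unfolding s_def by auto
  define g where "g i b = {a \<in> carrier A. h a i = b}" for i b
  define u where "u i X = h (SOME a. a \<in> X) i" for i and X :: "'a set"
  have Bcl: "om_closed (B i)" if "i \<in> I" for i
    using emb that unfolding subdirect_embedding_def by blast
  have surj: "(\<lambda>a. h a i) ` carrier A = carrier (B i)" if "i \<in> I" for i
    using emb that unfolding subdirect_embedding_def by blast
  have inj: "inj_on h (carrier A)" and hh: "h \<in> om_hom A (om_product I B)"
    using emb unfolding subdirect_embedding_def by auto
  have hc: "h a i \<in> carrier (B i)" if "i \<in> I" "a \<in> carrier A" for i a
    using surj[OF that(1)] that(2) by auto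
  have hm: "h (a \<otimes>\<^bsub>A\<^esub> b) i = h a i \<otimes>\<^bsub>B i\<^esub> h b i"
      "h (minop A a b) i = minop (B i) (h a i) (h b i)"
      "h (maxop A a b) i = maxop (B i) (h a i) (h b i)" "h \<one>\<^bsub>A\<^esub> i = \<one>\<^bsub>B i\<^esub>"
    if "i \<in> I" "a \<in> carrier A" "b \<in> carrier A" for a b i
    using hh that unfolding om_hom_def hom_def om_product_def by simp_all
  have one: "\<one>\<^bsub>A\<^esub> \<in> carrier A" using cl unfolding om_closed_def by simp
  have hom: "(\<lambda>a. h a i) \<in> om_hom A (B i)" if i: "i \<in> I" for i
    using hc[OF i] hm[OF i] one unfolding om_hom_def hom_def by simp
  have ug: "u i (g i b) = b" if ib: "i \<in> I" "b \<in> carrier (B i)" for i b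
  proof -
    have "b \<in> (\<lambda>a. h a i) ` carrier A" using surj[OF ib(1)] ib(2) by simp
    then obtain a where "a \<in> carrier A" "h a i = b" by auto
    then have "a \<in> g i b" by (simp add: g_def)
    then have "(SOME a. a \<in> g i b) \<in> g i b" by (rule someI)
    then show ?thesis unfolding u_def by (simp add: g_def)
  qed
  define Q where "Q k = (let i = s k in
     \<lparr>carrier = g i ` carrier (B i),
      mult = (\<lambda>X Y. g i (u i X \<otimes>\<^bsub>B i\<^esub> u i Y)), one = g i \<one>\<^bsub>B i\<^esub>,
      minop = (\<lambda>X Y. g i (minop (B i) (u i X) (u i Y))),
      maxop = (\<lambda>X Y. g i (maxop (B i) (u i X) (u i Y)))\<rparr>)" for k
  define H where "H a = (\<lambda>k\<in>K ` I. g (s k) (h a (s k)))" for a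
  have Hhom: "H \<in> om_hom A (om_product (K ` I) Q)"
  proof -
    have "H a \<in> (\<Pi>\<^sub>E k\<in>K ` I. carrier (Q k))" if "a \<in> carrier A" for a
    proof (rule PiE_I)
      show "H a k \<in> carrier (Q k)" if "k \<in> K ` I" for k
        using s(1)[OF that] \<open>a \<in> carrier A\<close> that hc by (simp add: H_def Q_def Let_def)
    qed (simp add: H_def)
    moreover have "H (a \<otimes>\<^bsub>A\<^esub> b) = (\<lambda>k\<in>K ` I. H a k \<otimes>\<^bsub>Q k\<^esub> H b k)"
      "H (minop A a b) = (\<lambda>k\<in>K ` I. minop (Q k) (H a k) (H b k))"
      "H (maxop A a b) = (\<lambda>k\<in>K ` I. maxop (Q k) (H a k) (H b k))"
      if ab: "a \<in> carrier A" "b \<in> carrier A" for a b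
      unfolding H_def by (rule restrict_ext; use s(1) ab in \<open>simp add: Q_def Let_def ug hc hm\<close>)+
    moreover have "H \<one>\<^bsub>A\<^esub> = (\<lambda>k\<in>K ` I. \<one>\<^bsub>Q k\<^esub>)"
      unfolding H_def by (rule restrict_ext) (use s(1) one in \<open>simp add: Q_def Let_def hm(4)\<close>)
    ultimately show ?thesis
      unfolding om_hom_def hom_def om_product_def by simp
  qed
  have geq: "g (s k) (h a (s k)) = g (s k) (h b (s k)) \<longleftrightarrow> (a, b) \<in> k"
    if "k \<in> K ` I" "a \<in> carrier A" "b \<in> carrier A" for k a b
  proof -
    have "g (s k) (h a (s k)) = g (s k) (h b (s k)) \<longleftrightarrow> h a (s k) = h b (s k)"
      using that ug[OF s(1) hc] s(1) by metis
    also have "\<dots> \<longleftrightarrow> (a, b) \<in> K (s k)" using that by (simp add: K_def)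
    finally show ?thesis using s(2) that by simp
  qed
  have Hinj: "inj_on H (carrier A)"
  proof (rule inj_onI)
    fix a b assume a: "a \<in> carrier A" and b: "b \<in> carrier A" and eq: "H a = H b"
    have "h a i = h b i" for i
    proof (cases "i \<in> I")
      case True
      then have "H a (K i) = H b (K i)" using eq by simp
      then have "(a, b) \<in> K i" using geq[of "K i" a b] True a b by (simp add: H_def)
      then show ?thesis by (simp add: K_def)
    next
      case False
      have "h a \<in> extensional I" "h b \<in> extensional I"
        using hh a b unfolding om_hom_def hom_def om_product_def PiE_def by auto
      then show ?thesis using False extensional_arb by metis
    qed
    then have "h a = h b" by (rule ext)
    then show "a = b" using inj a b by (simp add: inj_onD)
  qed
  have Qcl: "om_closed (Q k)" if "k \<in> K ` I" for k
    using Bcl[OF s(1)[OF that]] s(1)[OF that]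
    unfolding om_closed_def by (simp add: Q_def Let_def ug)
  have Qsurj: "(\<lambda>a. H a k) ` carrier A = carrier (Q k)" if "k \<in> K ` I" for k
  proof -
    have "carrier (Q k) = g (s k) ` (\<lambda>a. h a (s k)) ` carrier A"
      using surj[OF s(1)[OF that]] by (simp add: Q_def Let_def)
    then show ?thesis using that by (simp add: H_def image_image)
  qed
  have "subdirect_embedding (K ` I) Q A H"
    unfolding subdirect_embedding_def by (simp add: Hhom Hinj Qcl Qsurj)
  from si[unfolded subdirectly_irreducible_def, rule_format, OF this]
  obtain k where k: "k \<in> K ` I" and "(\<lambda>a. H a k) \<in> om_iso A (Q k)" by (rule bexE)
  then have injk: "inj_on (\<lambda>a. H a k) (carrier A)" unfolding om_iso_def bij_betw_def by blast
  obtain i where i: "i \<in> I" "k = K i" using k by blast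
  have "inj_on (\<lambda>a. h a i) (carrier A)"
  proof (rule inj_onI)
    fix a b assume ab: "a \<in> carrier A" "b \<in> carrier A" "h a i = h b i"
    then have "(a, b) \<in> k" using i by (simp add: K_def)
    then have "H a k = H b k" using geq[OF k ab(1,2)] k by (simp add: H_def)
    then show "a = b" using injk ab by (simp add: inj_onD)
  qed
  then have "(\<lambda>a. h a i) \<in> om_iso A (B i)"
    using hom[OF i(1)] surj[OF i(1)] unfolding om_iso_def bij_betw_def by blast
  then show ?thesis using i(1) by blast
qed

lemma idempotent_ordered_monoid_om_of_order:
  assumes "u \<in> X"
    and "\<forall>a\<in>X. \<forall>b\<in>X. m a b \<in> X" and "\<forall>a\<in>X. \<forall>b\<in>X. \<forall>c\<in>X. m (m a b) c = m a (m b c)"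
    and "\<forall>a\<in>X. m u a = a \<and> m a u = a \<and> m a a = a"
    and "\<forall>a\<in>X. R a a" and "\<forall>a\<in>X. \<forall>b\<in>X. R a b \<or> R b a"
    and "\<forall>a\<in>X. \<forall>b\<in>X. R a b \<longrightarrow> R b a \<longrightarrow> a = b"
    and "\<forall>a\<in>X. \<forall>b\<in>X. \<forall>c\<in>X. R a b \<longrightarrow> R b c \<longrightarrow> R a c"
    and "\<forall>a\<in>X. \<forall>b\<in>X. \<forall>c\<in>X. R a b \<longrightarrow> R (m c a) (m c b) \<and> R (m a c) (m b c)"
  shows "idempotent_ordered_monoid (om_of_order X m u R)"
proof -
  let ?S = "om_of_order X m u R"
  have S: "carrier ?S = X" "mult ?S = m" "one ?S = u"
    "minop ?S = (\<lambda>a b. if R a b then a else b)" "maxop ?S = (\<lambda>a b. if R a b then b else a)"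
    by (simp_all add: om_of_order_def)
  have le: "leq ?S x y \<longleftrightarrow> R x y" if "x \<in> X" for x y
    using assms(5) that by (auto simp: leq_def S)
  show ?thesis
  proof
    show "linear_order_on (carrier ?S) {(a, b). a \<in> carrier ?S \<and> b \<in> carrier ?S \<and> leq ?S a b}"
      unfolding order_on_defs refl_on_def total_on_def
    proof (intro conjI)
      show "trans {(a, b). a \<in> carrier ?S \<and> b \<in> carrier ?S \<and> leq ?S a b}"
        by (intro transI) (clarsimp simp: S le, use assms(8) in blast)
      show "antisym {(a, b). a \<in> carrier ?S \<and> b \<in> carrier ?S \<and> leq ?S a b}"
        by (intro antisymI) (clarsimp simp: S le, use assms(7) in blast)
    qed (use assms(5,6) in \<open>auto simp: S le\<close>)
    show "leq ?S (c \<otimes>\<^bsub>?S\<^esub> a \<otimes>\<^bsub>?S\<^esub> d) (c \<otimes>\<^bsub>?S\<^esub> b \<otimes>\<^bsub>?S\<^esub> d)"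
      if "a \<in> carrier ?S" "b \<in> carrier ?S" "c \<in> carrier ?S" "d \<in> carrier ?S" "leq ?S a b" for a b c d
      using that assms(2,9) by (simp add: S le)
  qed (use assms(1-4) in \<open>simp_all add: S le\<close>)
qed

lemma components_idempotent_ordered_monoid:
  assumes "A \<in> {C2, C2d, G3, D3}"
  shows "idempotent_ordered_monoid A"
proof -
  have "idempotent_ordered_monoid C2" unfolding C2_def
    by (rule idempotent_ordered_monoid_om_of_order) (simp_all add: mult_left_def)
  moreover have "idempotent_ordered_monoid C2d" unfolding C2d_def
    by (rule idempotent_ordered_monoid_om_of_order) (simp_all add: mult_left_def)
  moreover have "idempotent_ordered_monoid G3" unfolding G3_def
    by (rule idempotent_ordered_monoid_om_of_order) (simp_all add: mult_left_def)
  moreover have "idempotent_ordered_monoid D3" unfolding D3_def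
    by (rule idempotent_ordered_monoid_om_of_order) (simp_all add: mult_right_def)
  ultimately show ?thesis using assms by blast
qed

context
  fixes C :: "'c set" and r :: "'c rel" and M :: "'c \<Rightarrow> 'm om_algebra"
  assumes C: "linear_order_on C r" and M: "\<And>c. c \<in> C \<Longrightarrow> idempotent_ordered_monoid (M c)"
begin

private abbreviation lt :: "'c \<Rightarrow> 'c \<Rightarrow> bool" where
  "lt c d \<equiv> (c, d) \<in> r \<and> c \<noteq> d"

private abbreviation nle :: "('c \<times> 'm) option \<Rightarrow> ('c \<times> 'm) option \<Rightarrow> bool" where
  "nle \<equiv> nested_le C r M"

private abbreviation nm :: "('c \<times> 'm) option \<Rightarrow> ('c \<times> 'm) option \<Rightarrow> ('c \<times> 'm) option" where
  "nm \<equiv> nested_mult r M"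

private lemma chain_facts:
  "lt c d \<Longrightarrow> \<not> lt d c" "lt c d \<Longrightarrow> lt d k \<Longrightarrow> lt c k"
  "c \<in> C \<Longrightarrow> d \<in> C \<Longrightarrow> c = d \<or> lt c d \<or> lt d c"
  "(c, d) \<in> r \<Longrightarrow> c \<in> C \<and> d \<in> C"
proof -
  have R: "r \<subseteq> C \<times> C" "trans r" "antisym r" "total_on C r"
    using C unfolding order_on_defs by simp_all
  show "lt c d \<Longrightarrow> \<not> lt d c" using antisymD[OF R(3), of c d] by blast
  then show "lt c d \<Longrightarrow> lt d k \<Longrightarrow> lt c k" using transD[OF R(2), of c d k] by blast
  show "c \<in> C \<Longrightarrow> d \<in> C \<Longrightarrow> c = d \<or> lt c d \<or> lt d c"
    using R(4) unfolding total_on_def by blast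
  show "(c, d) \<in> r \<Longrightarrow> c \<in> C \<and> d \<in> C" using R(1) by blast
qed

private lemma M_facts:
  assumes "c \<in> C"
  shows "\<one>\<^bsub>M c\<^esub> \<in> carrier (M c)"
    and "a \<in> carrier (M c) \<Longrightarrow> \<one>\<^bsub>M c\<^esub> \<otimes>\<^bsub>M c\<^esub> a = a"
    and "a \<in> carrier (M c) \<Longrightarrow> a \<otimes>\<^bsub>M c\<^esub> \<one>\<^bsub>M c\<^esub> = a"
    and "a \<in> carrier (M c) \<Longrightarrow> b \<in> carrier (M c) \<Longrightarrow> a \<otimes>\<^bsub>M c\<^esub> b \<in> carrier (M c)"
    and "a \<in> carrier (M c) \<Longrightarrow> b \<in> carrier (M c) \<Longrightarrow> k \<in> carrier (M c) \<Longrightarrow>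
      a \<otimes>\<^bsub>M c\<^esub> b \<otimes>\<^bsub>M c\<^esub> k = a \<otimes>\<^bsub>M c\<^esub> (b \<otimes>\<^bsub>M c\<^esub> k)"
    and "a \<in> carrier (M c) \<Longrightarrow> a \<otimes>\<^bsub>M c\<^esub> a = a"
    and "a \<in> carrier (M c) \<Longrightarrow> leq (M c) a a"
    and "a \<in> carrier (M c) \<Longrightarrow> b \<in> carrier (M c) \<Longrightarrow> k \<in> carrier (M c) \<Longrightarrow>
      leq (M c) a b \<Longrightarrow> leq (M c) b k \<Longrightarrow> leq (M c) a k"
    and "a \<in> carrier (M c) \<Longrightarrow> b \<in> carrier (M c) \<Longrightarrow>
      leq (M c) a b \<Longrightarrow> leq (M c) b a \<Longrightarrow> a = b"
    and "a \<in> carrier (M c) \<Longrightarrow> b \<in> carrier (M c) \<Longrightarrow> leq (M c) a b \<or> leq (M c) b a"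
    and "a \<in> carrier (M c) \<Longrightarrow> b \<in> carrier (M c) \<Longrightarrow> k \<in> carrier (M c) \<Longrightarrow>
      leq (M c) a b \<Longrightarrow> leq (M c) (k \<otimes>\<^bsub>M c\<^esub> a) (k \<otimes>\<^bsub>M c\<^esub> b)"
    and "a \<in> carrier (M c) \<Longrightarrow> b \<in> carrier (M c) \<Longrightarrow> k \<in> carrier (M c) \<Longrightarrow>
      leq (M c) a b \<Longrightarrow> leq (M c) (a \<otimes>\<^bsub>M c\<^esub> k) (b \<otimes>\<^bsub>M c\<^esub> k)"
proof -
  interpret idempotent_ordered_monoid "M c" using M[OF assms] .
  show "\<one>\<^bsub>M c\<^esub> \<in> carrier (M c)" by (rule one_closed)
  show "a \<in> carrier (M c) \<Longrightarrow> \<one>\<^bsub>M c\<^esub> \<otimes>\<^bsub>M c\<^esub> a = a" by (rule l_one)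
  show "a \<in> carrier (M c) \<Longrightarrow> a \<otimes>\<^bsub>M c\<^esub> \<one>\<^bsub>M c\<^esub> = a" by (rule r_one)
  show "a \<in> carrier (M c) \<Longrightarrow> b \<in> carrier (M c) \<Longrightarrow> a \<otimes>\<^bsub>M c\<^esub> b \<in> carrier (M c)"
    by (rule m_closed)
  show "a \<in> carrier (M c) \<Longrightarrow> b \<in> carrier (M c) \<Longrightarrow> k \<in> carrier (M c) \<Longrightarrow>
      a \<otimes>\<^bsub>M c\<^esub> b \<otimes>\<^bsub>M c\<^esub> k = a \<otimes>\<^bsub>M c\<^esub> (b \<otimes>\<^bsub>M c\<^esub> k)" by (rule m_assoc)
  show "a \<in> carrier (M c) \<Longrightarrow> a \<otimes>\<^bsub>M c\<^esub> a = a" by (rule idempotent)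
  let ?R = "{(a, b). a \<in> carrier (M c) \<and> b \<in> carrier (M c) \<and> leq (M c) a b}"
  have R: "refl_on (carrier (M c)) ?R" "trans ?R" "antisym ?R" "total_on (carrier (M c)) ?R"
    using linear unfolding order_on_defs by simp_all
  show refl: "a \<in> carrier (M c) \<Longrightarrow> leq (M c) a a" for a
    using refl_onD[OF R(1), of a] by simp
  show "a \<in> carrier (M c) \<Longrightarrow> b \<in> carrier (M c) \<Longrightarrow> k \<in> carrier (M c) \<Longrightarrow>
      leq (M c) a b \<Longrightarrow> leq (M c) b k \<Longrightarrow> leq (M c) a k"
    using transD[OF R(2), of a b k] by simp
  show "a \<in> carrier (M c) \<Longrightarrow> b \<in> carrier (M c) \<Longrightarrow>
      leq (M c) a b \<Longrightarrow> leq (M c) b a \<Longrightarrow> a = b"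
    using antisymD[OF R(3), of a b] by simp
  show "a \<in> carrier (M c) \<Longrightarrow> b \<in> carrier (M c) \<Longrightarrow> leq (M c) a b \<or> leq (M c) b a"
    using R(4) refl[of a] unfolding total_on_def by (cases "a = b") auto
  show "a \<in> carrier (M c) \<Longrightarrow> b \<in> carrier (M c) \<Longrightarrow> k \<in> carrier (M c) \<Longrightarrow>
      leq (M c) a b \<Longrightarrow> leq (M c) (k \<otimes>\<^bsub>M c\<^esub> a) (k \<otimes>\<^bsub>M c\<^esub> b)"
    using compatible[of a b k "\<one>\<^bsub>M c\<^esub>"] by simp
  show "a \<in> carrier (M c) \<Longrightarrow> b \<in> carrier (M c) \<Longrightarrow> k \<in> carrier (M c) \<Longrightarrow>
      leq (M c) a b \<Longrightarrow> leq (M c) (a \<otimes>\<^bsub>M c\<^esub> k) (b \<otimes>\<^bsub>M c\<^esub> k)"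
    using compatible[of a b "\<one>\<^bsub>M c\<^esub>" k] by simp
qed

private lemma carrier_cases:
  assumes "x \<in> nested_carrier C M"
  obtains "x = None" | c a where "c \<in> C" "a \<in> carrier (M c)" "a \<noteq> \<one>\<^bsub>M c\<^esub>" "x = Some (c, a)"
  using assms unfolding nested_carrier_def emb_def by (auto split: if_splits)

private lemma carrier_iff:
  "None \<in> nested_carrier C M"
  "Some (c, a) \<in> nested_carrier C M \<longleftrightarrow> c \<in> C \<and> a \<in> carrier (M c) \<and> a \<noteq> \<one>\<^bsub>M c\<^esub>"
  unfolding nested_carrier_def emb_def by (auto split: if_splits)

private lemma emb_carrier: "c \<in> C \<Longrightarrow> a \<in> carrier (M c) \<Longrightarrow> emb M c a \<in> nested_carrier C M"
  unfolding nested_carrier_def by auto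

private lemma nle_iff:
  "nle None None"
  "c \<in> C \<Longrightarrow> a \<in> carrier (M c) \<Longrightarrow> a \<noteq> \<one>\<^bsub>M c\<^esub> \<Longrightarrow> nle (Some (c, a)) None \<longleftrightarrow> leq (M c) a \<one>\<^bsub>M c\<^esub>"
  "c \<in> C \<Longrightarrow> a \<in> carrier (M c) \<Longrightarrow> a \<noteq> \<one>\<^bsub>M c\<^esub> \<Longrightarrow> nle None (Some (c, a)) \<longleftrightarrow> leq (M c) \<one>\<^bsub>M c\<^esub> a"
  "c \<in> C \<Longrightarrow> a \<in> carrier (M c) \<Longrightarrow> a \<noteq> \<one>\<^bsub>M c\<^esub> \<Longrightarrow>
     d \<in> C \<Longrightarrow> b \<in> carrier (M d) \<Longrightarrow> b \<noteq> \<one>\<^bsub>M d\<^esub> \<Longrightarrow>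
     nle (Some (c, a)) (Some (d, b)) \<longleftrightarrow>
       c = d \<and> leq (M c) a b \<or> lt c d \<and> leq (M c) a \<one>\<^bsub>M c\<^esub> \<or> lt d c \<and> leq (M d) \<one>\<^bsub>M d\<^esub> b"
proof -
  show "nle None None" by (rule nested_le.unit)
  note I = nested_le.component[of _ C _ M _ r] nested_le.below[of _ C _ r _ M] nested_le.above[of _ C _ r _ M]
  show "nle (Some (c, a)) None \<longleftrightarrow> leq (M c) a \<one>\<^bsub>M c\<^esub>" (is "?L \<longleftrightarrow> ?R")
    and "nle None (Some (c, a)) \<longleftrightarrow> leq (M c) \<one>\<^bsub>M c\<^esub> a" (is "?L' \<longleftrightarrow> ?R'")
    if as: "c \<in> C" "a \<in> carrier (M c)" "a \<noteq> \<one>\<^bsub>M c\<^esub>"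
  proof -
    have e: "emb M c a = Some (c, a)" "emb M c \<one>\<^bsub>M c\<^esub> = None" using as by (simp_all add: emb_def)
    have "?R" if ?L
      using that by cases (use as in \<open>simp_all add: emb_def split: if_splits\<close>)
    then show "?L \<longleftrightarrow> ?R" using I(1)[of c a "\<one>\<^bsub>M c\<^esub>"] as M_facts(1)[of c] e by auto
    have "?R'" if ?L'
      using that by cases (use as in \<open>simp_all add: emb_def split: if_splits\<close>)
    then show "?L' \<longleftrightarrow> ?R'" using I(1)[of c "\<one>\<^bsub>M c\<^esub>" a] as M_facts(1)[of c] e by auto
  qed
  show "nle (Some (c, a)) (Some (d, b)) \<longleftrightarrow>
      c = d \<and> leq (M c) a b \<or> lt c d \<and> leq (M c) a \<one>\<^bsub>M c\<^esub> \<or> lt d c \<and> leq (M d) \<one>\<^bsub>M d\<^esub> b"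
    (is "?L \<longleftrightarrow> ?R")
    if as: "c \<in> C" "a \<in> carrier (M c)" "a \<noteq> \<one>\<^bsub>M c\<^esub>" "d \<in> C" "b \<in> carrier (M d)" "b \<noteq> \<one>\<^bsub>M d\<^esub>"
  proof
    show ?R if ?L
      using that by cases (simp_all add: emb_def split: if_splits)
    have "emb M c a = Some (c, a)" "emb M d b = Some (d, b)" using as by (simp_all add: emb_def)
    then show ?L if ?R
      using that as I(1)[of c a b] I(2)[of c d a b] I(3)[of d c b a] by (elim disjE conjE) simp_all
  qed
qed

private lemma nm_emb:
  assumes "c \<in> C" "d \<in> C" "a \<in> carrier (M c)" "b \<in> carrier (M d)"
  shows "nm (emb M c a) (emb M d b) =
    (if c = d then emb M c (a \<otimes>\<^bsub>M c\<^esub> b)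
     else if a = \<one>\<^bsub>M c\<^esub> then emb M d b
     else if b = \<one>\<^bsub>M d\<^esub> then emb M c a
     else if lt c d then emb M c a else emb M d b)"
  using assms by (auto simp: emb_def M_facts(1-7))

private lemma nm_closed:
  "x \<in> nested_carrier C M \<Longrightarrow> y \<in> nested_carrier C M \<Longrightarrow> nm x y \<in> nested_carrier C M"
  by (elim carrier_cases) (auto simp: carrier_iff M_facts(1-6) emb_carrier)

private lemma nm_None: "nm x None = x"
  by (cases x) auto

private lemma M_ne:
  assumes "c \<in> C" "a \<in> carrier (M c)" "a \<noteq> \<one>\<^bsub>M c\<^esub>" "b \<in> carrier (M c)"
  shows "a \<otimes>\<^bsub>M c\<^esub> b \<noteq> \<one>\<^bsub>M c\<^esub>"
  using M_facts(3)[OF assms(1,2)] M_facts(5)[OF assms(1,2,2,4)] M_facts(6)[OF assms(1,2)] assms(3)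
  by metis

private lemma nm_assoc:
  assumes "x \<in> nested_carrier C M" "y \<in> nested_carrier C M" "z \<in> nested_carrier C M"
  shows "nm (nm x y) z = nm x (nm y z)"
  using assms(1)
proof (cases rule: carrier_cases)
  case x: (2 c a)
  show ?thesis using assms(2)
  proof (cases rule: carrier_cases)
    case y: (2 d b)
    show ?thesis using assms(3)
    proof (cases rule: carrier_cases)
      case z: (2 k e)
      have m: "nm (Some (i, u)) (Some (j, v)) =
          (if i = j then Some (i, u \<otimes>\<^bsub>M i\<^esub> v) else if lt i j then Some (i, u) else Some (j, v))"
        if "i \<in> C" "u \<in> carrier (M i)" "u \<noteq> \<one>\<^bsub>M i\<^esub>" "v \<in> carrier (M j)" for i j u v
        using M_ne[OF that(1-3)] that(4) by (auto simp: emb_def)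
      note n = M_ne[OF x(1-3)] M_ne[OF y(1-3)] M_facts(4)[OF x(1,2)] M_facts(4)[OF y(1,2)]
      show ?thesis
      proof (cases "c = d")
        case True
        then show ?thesis
          using x y z n by (cases "d = k") (auto simp: m M_facts(5) simp del: nested_mult.simps)
      next
        case cd: False
        show ?thesis
        proof (cases "d = k")
          case True
          then show ?thesis
            using x y z n cd by (auto simp: m simp del: nested_mult.simps)
        next
          case dk: False
          then consider "lt c d" "lt d k" "lt c k" "c \<noteq> k" | "lt c d" "\<not> lt d k" | "\<not> lt c d" "lt d k"
            | "\<not> lt c d" "\<not> lt d k" "\<not> lt c k" "c \<noteq> k"
            using cd chain_facts(1)[of c d] chain_facts(2)[of c d k] chain_facts(2)[of k d c]
              chain_facts(3)[OF x(1) y(1)] chain_facts(3)[OF y(1) z(1)] chain_facts(1)[of c k] by metis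
          then show ?thesis
            unfolding x(4) y(4) z(4)
            by cases (use cd dk x(1-3) y(1-3) z(1-3) in \<open>simp_all add: m del: nested_mult.simps\<close>)
        qed
      qed
    qed (auto simp: nm_None)
  qed (auto simp: nm_None)
qed simp

private lemma leq_one:
  assumes "c \<in> C" "a \<in> carrier (M c)" "a \<noteq> \<one>\<^bsub>M c\<^esub>"
  shows "leq (M c) \<one>\<^bsub>M c\<^esub> a \<longleftrightarrow> \<not> leq (M c) a \<one>\<^bsub>M c\<^esub>"
  using M_facts(1)[OF assms(1)] M_facts(9)[OF assms(1,2)] M_facts(10)[OF assms(1,2)] assms(3) by blast

private lemma nle_refl: "x \<in> nested_carrier C M \<Longrightarrow> nle x x"
  by (erule carrier_cases) (simp_all add: nle_iff M_facts(7))

private lemma nle_total: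
  assumes "x \<in> nested_carrier C M" "y \<in> nested_carrier C M"
  shows "nle x y \<or> nle y x"
  using assms(1)
proof (cases rule: carrier_cases)
  case x: 1
  show ?thesis using assms(2)
    by (cases rule: carrier_cases) (simp_all add: x nle_iff leq_one)
next
  case x: (2 c a)
  show ?thesis using assms(2)
  proof (cases rule: carrier_cases)
    case y: (2 d b)
    show ?thesis
      using chain_facts(3)[OF x(1) y(1)]
    proof (elim disjE)
      assume "c = d"
      then show ?thesis using M_facts(10)[OF x(1,2), of b] y x(1-3) unfolding x(4) y(4)
        by (auto simp: nle_iff)
    qed (use x(1-3) y(1-3) in \<open>auto simp: x(4) y(4) nle_iff leq_one\<close>)
  qed (use x in \<open>simp add: nle_iff leq_one\<close>)
qed

private lemma nle_antisym:
  assumes "x \<in> nested_carrier C M" "y \<in> nested_carrier C M" "nle x y" "nle y x"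
  shows "x = y"
  using assms(1)
proof (cases rule: carrier_cases)
  case x: 1
  show ?thesis using assms(2)
    by (cases rule: carrier_cases) (use assms(3,4) in \<open>simp_all add: x nle_iff leq_one\<close>)
next
  case x: (2 c a)
  show ?thesis using assms(2)
  proof (cases rule: carrier_cases)
    case y: (2 d b)
    have xy: "c = d \<and> leq (M c) a b \<or> lt c d \<and> leq (M c) a \<one>\<^bsub>M c\<^esub> \<or> lt d c \<and> \<not> leq (M d) b \<one>\<^bsub>M d\<^esub>"
      "d = c \<and> leq (M d) b a \<or> lt d c \<and> leq (M d) b \<one>\<^bsub>M d\<^esub> \<or> lt c d \<and> \<not> leq (M c) a \<one>\<^bsub>M c\<^esub>"
      using assms(3,4) x(1-3) y(1-3) unfolding x(4) y(4) by (simp_all add: nle_iff leq_one)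
    then have "c = d \<and> leq (M c) a b \<and> leq (M c) b a" using chain_facts(1)[of c d] by blast
    then have "c = d" "a = b" using M_facts(9)[OF x(1,2), of b] y(2) by blast+
    then show ?thesis using x(4) y(4) by simp
  qed (use assms(3,4) x in \<open>simp add: nle_iff leq_one\<close>)
qed

private lemma nle_trans:
  assumes xc: "x \<in> nested_carrier C M" and yc: "y \<in> nested_carrier C M"
    and zc: "z \<in> nested_carrier C M" and xy: "nle x y" and yz: "nle y z"
  shows "nle x z"
proof -
  have T: "leq (M c) a b \<Longrightarrow> leq (M c) b \<one>\<^bsub>M c\<^esub> \<Longrightarrow> leq (M c) a \<one>\<^bsub>M c\<^esub>"
    if "c \<in> C" "a \<in> carrier (M c)" "b \<in> carrier (M c)" for c a b
    using M_facts(8)[OF that] M_facts(1)[OF that(1)] by blast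
  have U: "leq (M c) a \<one>\<^bsub>M c\<^esub> \<Longrightarrow> \<not> leq (M c) b \<one>\<^bsub>M c\<^esub> \<Longrightarrow> leq (M c) a b"
    if "c \<in> C" "a \<in> carrier (M c)" "b \<in> carrier (M c)" for c a b
    using M_facts(8)[OF that(1,2) M_facts(1)[OF that(1)] that(3)]
      M_facts(10)[OF that(1) M_facts(1)[OF that(1)] that(3)] by blast
  show ?thesis using xc
  proof (cases rule: carrier_cases)
    case x: 1
    show ?thesis using yc
    proof (cases rule: carrier_cases)
      case y: 1
      then show ?thesis using x yz by simp
    next
      case y: (2 d b)
      show ?thesis using zc
      proof (cases rule: carrier_cases)
        case z: 1
        then show ?thesis using x nle_iff(1) by simp
      next
        case z: (2 k e)
        have "\<not> leq (M d) b \<one>\<^bsub>M d\<^esub>"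
          using xy y(1-3) unfolding x y(4) by (simp add: nle_iff leq_one)
        moreover have "d = k \<and> leq (M d) b e \<or> lt d k \<and> leq (M d) b \<one>\<^bsub>M d\<^esub> \<or> lt k d \<and> \<not> leq (M k) e \<one>\<^bsub>M k\<^esub>"
          using yz y(1-3) z(1-3) unfolding y(4) z(4) by (simp add: nle_iff leq_one)
        ultimately have "\<not> leq (M k) e \<one>\<^bsub>M k\<^esub>" using T[OF y(1,2), of e] z(2) by blast
        then show ?thesis using z(1-3) unfolding x z(4) by (simp add: nle_iff leq_one)
      qed
    qed
  next
    case x: (2 c a)
    show ?thesis using yc
    proof (cases rule: carrier_cases)
      case y: 1
      have a: "leq (M c) a \<one>\<^bsub>M c\<^esub>" using xy x(1-3) unfolding x(4) y by (simp add: nle_iff)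
      show ?thesis using zc
      proof (cases rule: carrier_cases)
        case z: 1
        then show ?thesis using xy y by simp
      next
        case z: (2 k e)
        have e: "\<not> leq (M k) e \<one>\<^bsub>M k\<^esub>"
          using yz z(1-3) unfolding y z(4) by (simp add: nle_iff leq_one)
        have "c = k \<and> leq (M c) a e \<or> lt c k \<and> leq (M c) a \<one>\<^bsub>M c\<^esub> \<or> lt k c \<and> \<not> leq (M k) e \<one>\<^bsub>M k\<^esub>"
          using a e U[OF x(1,2), of e] chain_facts(3)[OF x(1) z(1)] z(2) by blast
        then show ?thesis using x(1-3) z(1-3) unfolding x(4) z(4) by (simp add: nle_iff leq_one)
      qed
    next
      case y: (2 d b)
      have xy': "c = d \<and> leq (M c) a b \<or> lt c d \<and> leq (M c) a \<one>\<^bsub>M c\<^esub> \<or> lt d c \<and> \<not> leq (M d) b \<one>\<^bsub>M d\<^esub>"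
        using xy x(1-3) y(1-3) unfolding x(4) y(4) by (simp add: nle_iff leq_one)
      show ?thesis using zc
      proof (cases rule: carrier_cases)
        case z: 1
        have "leq (M d) b \<one>\<^bsub>M d\<^esub>" using yz y(1-3) unfolding y(4) z by (simp add: nle_iff)
        then have "leq (M c) a \<one>\<^bsub>M c\<^esub>" using xy' T[OF x(1,2), of b] y(2) by blast
        then show ?thesis using x(1-3) unfolding x(4) z by (simp add: nle_iff)
      next
        case z: (2 k e)
        have yz': "d = k \<and> leq (M d) b e \<or> lt d k \<and> leq (M d) b \<one>\<^bsub>M d\<^esub> \<or> lt k d \<and> \<not> leq (M k) e \<one>\<^bsub>M k\<^esub>"
          using yz y(1-3) z(1-3) unfolding y(4) z(4) by (simp add: nle_iff leq_one)
        have "c = k \<and> leq (M c) a e \<or> lt c k \<and> leq (M c) a \<one>\<^bsub>M c\<^esub> \<or> lt k c \<and> \<not> leq (M k) e \<one>\<^bsub>M k\<^esub>"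
          using xy'
        proof (elim disjE conjE)
          assume 1: "c = d" "leq (M c) a b"
          then show ?thesis
            using yz' T[OF x(1,2), of b] M_facts(8)[OF x(1,2), of b e] y(2) z(2) by blast
        next
          assume 1: "(c, d) \<in> r" "c \<noteq> d" "leq (M c) a \<one>\<^bsub>M c\<^esub>"
          show ?thesis
            using yz'
          proof (elim disjE conjE)
            assume "(k, d) \<in> r" "k \<noteq> d" "\<not> leq (M k) e \<one>\<^bsub>M k\<^esub>"
            then show ?thesis
              using 1 U[OF x(1,2), of e] chain_facts(3)[OF x(1) z(1)] z(2) by blast
          qed (use 1 chain_facts(2)[of c d k] in blast)+
        next
          assume 1: "(d, c) \<in> r" "d \<noteq> c" "\<not> leq (M d) b \<one>\<^bsub>M d\<^esub>"
          then show ?thesis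
            using yz' T[OF y(1,2), of e] chain_facts(2)[of k d c] z(2) by blast
        qed
        then show ?thesis using x(1-3) z(1-3) unfolding x(4) z(4) by (simp add: nle_iff leq_one)
      qed
    qed
  qed
qed

private lemma nm_between:
  assumes "lt c d" "lt c k" "b \<in> carrier (M d)" "w \<in> carrier (M k)"
  obtains j v where "lt c j" "v \<in> carrier (M j)" "nm (emb M d b) (emb M k w) = emb M j v"
proof -
  have C': "d \<in> C" "k \<in> C" using chain_facts(4)[of c d] chain_facts(4)[of c k] assms(1,2) by blast+
  consider "d = k" | "nm (emb M d b) (emb M k w) = emb M d b" | "nm (emb M d b) (emb M k w) = emb M k w"
    using nm_emb[OF C' assms(3,4)] by presburger
  then show ?thesis
  proof cases
    case 1
    then have w: "w \<in> carrier (M d)" using assms(4) by simp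
    have "nm (emb M d b) (emb M k w) = emb M d (b \<otimes>\<^bsub>M d\<^esub> w)"
      using nm_emb[OF C' assms(3,4)] 1 by simp
    then show ?thesis using that[OF assms(1) M_facts(4)[OF C'(1) assms(3) w]] by simp
  next
    case 2
    then show ?thesis using that[OF assms(1,3)] by simp
  next
    case 3
    then show ?thesis using that[OF assms(2,4)] by simp
  qed
qed

private lemma nm_absorb:
  assumes "lt c d" "a \<in> carrier (M c)" "a \<noteq> \<one>\<^bsub>M c\<^esub>" "b \<in> carrier (M d)"
  shows "nm (emb M c a) (emb M d b) = emb M c a" "nm (emb M d b) (emb M c a) = emb M c a"
proof -
  have "c \<noteq> d" "d \<noteq> c" "(c, d) \<in> r" "(d, c) \<notin> r" using assms(1) chain_facts(1)[OF assms(1)] by blast+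
  then show "nm (emb M c a) (emb M d b) = emb M c a" "nm (emb M d b) (emb M c a) = emb M c a"
    using assms(3) by (simp_all add: emb_def)
qed

private lemma nm_mono_component:
  assumes c: "c \<in> C" and ab: "a \<in> carrier (M c)" "b \<in> carrier (M c)" "leq (M c) a b"
    and k: "k \<in> C" and w: "w \<in> carrier (M k)" "w \<noteq> \<one>\<^bsub>M k\<^esub>"
  shows "nle (nm (emb M k w) (emb M c a)) (nm (emb M k w) (emb M c b)) \<and>
    nle (nm (emb M c a) (emb M k w)) (nm (emb M c b) (emb M k w))"
  using chain_facts(3)[OF k c]
proof (elim disjE)
  assume [simp]: "k = c"
  have w': "w \<in> carrier (M c)" using w by simp
  have comp: "nle (emb M c u) (emb M c v)"
    if "u \<in> carrier (M c)" "v \<in> carrier (M c)" "leq (M c) u v" for u v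
    using c that by (rule nested_le.component)
  show ?thesis
    using nm_emb[OF c c w' ab(1)] nm_emb[OF c c w' ab(2)] nm_emb[OF c c ab(1) w'] nm_emb[OF c c ab(2) w']
      comp[OF M_facts(4)[OF c w' ab(1)] M_facts(4)[OF c w' ab(2)] M_facts(11)[OF c ab(1,2) w' ab(3)]]
      comp[OF M_facts(4)[OF c ab(1) w'] M_facts(4)[OF c ab(2) w'] M_facts(12)[OF c ab(1,2) w' ab(3)]]
    by simp
next
  assume "lt k c"
  from nm_absorb[OF this w] ab nle_refl[OF emb_carrier[OF k w(1)]] show ?thesis by simp
next
  assume ck: "lt c k"
  have one: "emb M c \<one>\<^bsub>M c\<^esub> = None" by (simp add: emb_def)
  have N: "nm None (emb M k w) = emb M k w" by simp
  note abs = nm_absorb[OF ck _ _ w(1)]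
  note aa = abs[OF ab(1)] and bb = abs[OF ab(2)]
  show ?thesis
  proof (cases "a = \<one>\<^bsub>M c\<^esub>")
    case a: True
    show ?thesis
    proof (cases "b = \<one>\<^bsub>M c\<^esub>")
      case True
      then show ?thesis using a one N nm_None nle_refl[OF emb_carrier[OF k w(1)]] by simp
    next
      case False
      have "nle (emb M k w) (emb M c b)"
        by (rule nested_le.above) (use c k ck ab(2,3) w(1) a False in auto)
      then show ?thesis using bb[OF False] unfolding a one nm_None N by simp
    qed
  next
    case a: False
    show ?thesis
    proof (cases "b = \<one>\<^bsub>M c\<^esub>")
      case True
      have "nle (emb M c a) (emb M k w)"
        by (rule nested_le.below) (use c k ck ab(1,3) w(1) a True in auto)
      then show ?thesis using aa[OF a] unfolding True one nm_None N by simp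
    next
      case False
      have "nle (emb M c a) (emb M c b)" using c ab by (rule nested_le.component)
      then show ?thesis using aa[OF a] bb[OF False] by simp
    qed
  qed
qed

private lemma nm_mono_below:
  assumes cd: "lt c d" and a: "a \<in> carrier (M c)" "a \<noteq> \<one>\<^bsub>M c\<^esub>" and b: "b \<in> carrier (M d)"
    and k: "k \<in> C" and w: "w \<in> carrier (M k)" "w \<noteq> \<one>\<^bsub>M k\<^esub>"
  shows "leq (M c) a \<one>\<^bsub>M c\<^esub> \<Longrightarrow>
      nle (nm (emb M k w) (emb M c a)) (nm (emb M k w) (emb M d b)) \<and>
      nle (nm (emb M c a) (emb M k w)) (nm (emb M d b) (emb M k w))" (is "_ \<Longrightarrow> ?below")
    and "leq (M c) \<one>\<^bsub>M c\<^esub> a \<Longrightarrow>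
      nle (nm (emb M k w) (emb M d b)) (nm (emb M k w) (emb M c a)) \<and>
      nle (nm (emb M d b) (emb M k w)) (nm (emb M c a) (emb M k w))" (is "_ \<Longrightarrow> ?above")
proof -
  have C': "c \<in> C" "d \<in> C" using chain_facts(4)[of c d] cd by blast+
  consider "k = c" | "lt k c" | "lt c k" using chain_facts(3)[OF k C'(1)] by blast
  then have "(leq (M c) a \<one>\<^bsub>M c\<^esub> \<longrightarrow> ?below) \<and> (leq (M c) \<one>\<^bsub>M c\<^esub> a \<longrightarrow> ?above)"
  proof cases
    case 1
    have one: "emb M d \<one>\<^bsub>M d\<^esub> = None" "emb M c \<one>\<^bsub>M c\<^esub> = None" by (simp_all add: emb_def)
    have w': "w \<in> carrier (M c)" "w \<noteq> \<one>\<^bsub>M c\<^esub>" using w 1 by simp_all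
    have e: "nm (emb M k w) (emb M d b) = nm (emb M k w) (emb M c \<one>\<^bsub>M c\<^esub>)"
      "nm (emb M d b) (emb M k w) = nm (emb M c \<one>\<^bsub>M c\<^esub>) (emb M k w)"
      using nm_absorb[OF cd w' b] 1 by (simp_all add: one nm_None)
    show ?thesis
      unfolding e
      using nm_mono_component[OF C'(1) a(1) M_facts(1)[OF C'(1)] _ k w]
        nm_mono_component[OF C'(1) M_facts(1)[OF C'(1)] a(1) _ k w] by blast
  next
    case 2
    have "lt k d" using 2 cd by (rule chain_facts(2))
    then show ?thesis
      using nm_absorb[OF 2 w a(1)] nm_absorb[OF _ w b] nle_refl[OF emb_carrier[OF k w(1)]] by simp
  next
    case 3
    have x: "nm (emb M k w) (emb M c a) = emb M c a" "nm (emb M c a) (emb M k w) = emb M c a"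
      using nm_absorb[OF 3 a w(1)] by simp_all
    obtain i u where i: "lt c i" "u \<in> carrier (M i)" "nm (emb M k w) (emb M d b) = emb M i u"
      using nm_between[OF 3 cd w(1) b] .
    obtain j v where j: "lt c j" "v \<in> carrier (M j)" "nm (emb M d b) (emb M k w) = emb M j v"
      using nm_between[OF cd 3 b w(1)] .
    have a': "a \<in> carrier (M c) - {\<one>\<^bsub>M c\<^esub>}" using a by simp
    have L: "nle (emb M c a) (emb M l t)" if "leq (M c) a \<one>\<^bsub>M c\<^esub>" "lt c l" "t \<in> carrier (M l)" for l t
      by (rule nested_le.below[OF C'(1) _ _ _ a' that(3,1)]) (use that(2) chain_facts(4)[of c l] in simp_all)
    have U: "nle (emb M l t) (emb M c a)" if "leq (M c) \<one>\<^bsub>M c\<^esub> a" "lt c l" "t \<in> carrier (M l)" for l t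
      by (rule nested_le.above[OF C'(1) _ _ _ a' that(3,1)]) (use that(2) chain_facts(4)[of c l] in simp_all)
    show ?thesis
      unfolding x i(3) j(3) using L[OF _ i(1,2)] L[OF _ j(1,2)] U[OF _ i(1,2)] U[OF _ j(1,2)] by blast
  qed
  then show "leq (M c) a \<one>\<^bsub>M c\<^esub> \<Longrightarrow> ?below" "leq (M c) \<one>\<^bsub>M c\<^esub> a \<Longrightarrow> ?above" by blast+
qed

private lemma nm_mono:
  assumes "nle x y" "z \<in> nested_carrier C M"
  shows "nle (nm z x) (nm z y) \<and> nle (nm x z) (nm y z)"
  using assms(2)
proof (cases rule: carrier_cases)
  case 1
  then show ?thesis using assms(1) by (simp add: nm_None)
next
  case z: (2 k w)
  have zw: "z = emb M k w" using z(3,4) by (simp add: emb_def)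
  show ?thesis using assms(1)
  proof cases
    case unit
    then show ?thesis using nle_refl[OF assms(2)] by (simp add: nm_None)
  next
    case (component c a b)
    show ?thesis
      unfolding component(1,2) zw by (rule nm_mono_component) (use component z in simp_all)
  next
    case (below c d a b)
    show ?thesis
      unfolding below(1,2) zw by (rule nm_mono_below(1)) (use below z in simp_all)
  next
    case (above c d a b)
    show ?thesis
      unfolding above(1,2) zw by (rule nm_mono_below(2)) (use above z in simp_all)
  qed
qed

lemma nested_sum_idempotent_ordered_monoid: "idempotent_ordered_monoid (nested_sum C r M)"
  unfolding nested_sum_def
proof (rule idempotent_ordered_monoid_om_of_order)
  show "\<forall>x\<in>nested_carrier C M. nm None x = x \<and> nm x None = x \<and> nm x x = x"
    by (auto elim!: carrier_cases simp: nm_None M_facts(1-7) emb_def)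
  show "\<forall>x\<in>nested_carrier C M. \<forall>y\<in>nested_carrier C M. \<forall>z\<in>nested_carrier C M.
      nle x y \<longrightarrow> nle y z \<longrightarrow> nle x z"
    using nle_trans by blast
  show "\<forall>x\<in>nested_carrier C M. \<forall>y\<in>nested_carrier C M. nle x y \<longrightarrow> nle y x \<longrightarrow> x = y"
    using nle_antisym by blast
qed (simp_all add: carrier_iff nm_closed nm_assoc nle_refl nle_total nm_mono)

end

end

theory Submission
  imports Defs
begin

text \<open>
  In the nested sum, the components further up the chain lie closer to the identity, and the
  non-identity elements of a component absorb everything above it. Call a non-identity element
  negative or positive according to its side of the identity.

  Absorption makes the identity class of a congruence an up-set of components
  (\<open>unit_class_up_closed\<close>), and conversely every principal up-set of components can be collapsed
  to the identity without identifying anything else (\<open>congruence_upper_block\<close>). The question is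
  therefore what a congruence can identify outside the identity class. Two related elements of
  opposite sign have the identity between them, so convexity of classes collapses both. Two related
  elements \<open>x\<close>, \<open>y\<close> of the same sign, in components \<open>c \<sqsubset> d\<close>, are both multiplied by an element
  \<open>z\<close> of the opposite sign from a component between \<open>c\<close> and \<open>d\<close> (inclusive): on a suitable side
  this gives \<open>x\<close> and \<open>z\<close>, so \<open>x\<close> collapses again. Hence \<open>x\<close> and \<open>y\<close> can stay outside the
  identity class only if the whole interval from \<open>c\<close> to \<open>d\<close> consists of copies of one and the
  same two-element component; and in that case identifying just the interval is a congruence
  (\<open>congruence_interval_block\<close>).

  If there is no such interval, a congruence is determined by its identity class
  (\<open>separated_related_iff\<close>). Up-sets of a chain are comparable, so the congruences form a chain,
  and collapsing the maximal component, if there is one, is the atom. If there is such an interval,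
  then identifying it, and collapsing everything from its upper end on, are nontrivial congruences
  with trivial intersection; if there is no maximal component, the congruences collapsing the
  principal up-sets have trivial intersection.

  These facts are compared through critical pairs, that is, pairs of distinct elements lying in all
  nontrivial congruences: they exist exactly in the subdirectly irreducible algebras
  (\<open>critical_pair_if_subdirectly_irreducible\<close>, \<open>subdirectly_irreducible_if_critical_pair\<close>), and
  a chain of congruences with an atom provides one (\<open>critical_pair_if_chain_with_atom\<close>).
\<close>

section \<open>Congruences and subdirect irreducibility\<close>

lemma congruenceD:
  assumes "congruence A \<theta>"
  shows "a \<in> carrier A \<Longrightarrow> (a, a) \<in> \<theta>"
    and "(a, b) \<in> \<theta> \<Longrightarrow> (b, a) \<in> \<theta>"
    and "(a, b) \<in> \<theta> \<Longrightarrow> (b, c) \<in> \<theta> \<Longrightarrow> (a, c) \<in> \<theta>"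
    and "(a, b) \<in> \<theta> \<Longrightarrow> a \<in> carrier A \<and> b \<in> carrier A"
    and "(a, b) \<in> \<theta> \<Longrightarrow> (c, d) \<in> \<theta> \<Longrightarrow> (a \<otimes>\<^bsub>A\<^esub> c, b \<otimes>\<^bsub>A\<^esub> d) \<in> \<theta>"
    and "(a, b) \<in> \<theta> \<Longrightarrow> (c, d) \<in> \<theta> \<Longrightarrow> (minop A a c, minop A b d) \<in> \<theta>"
    and "(a, b) \<in> \<theta> \<Longrightarrow> (c, d) \<in> \<theta> \<Longrightarrow> (maxop A a c, maxop A b d) \<in> \<theta>"
proof -
  have eq: "refl_on (carrier A) \<theta>" "sym \<theta>" "trans \<theta>" "\<theta> \<subseteq> carrier A \<times> carrier A"
    using assms unfolding congruence_def equiv_def by auto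
  show "a \<in> carrier A \<Longrightarrow> (a, a) \<in> \<theta>" using eq(1) by (rule refl_onD)
  show "(a, b) \<in> \<theta> \<Longrightarrow> (b, a) \<in> \<theta>" using eq(2) by (rule symD)
  show "(a, b) \<in> \<theta> \<Longrightarrow> (b, c) \<in> \<theta> \<Longrightarrow> (a, c) \<in> \<theta>" using eq(3) by (rule transD)
  show "(a, b) \<in> \<theta> \<Longrightarrow> a \<in> carrier A \<and> b \<in> carrier A" using eq(4) by blast
qed (use assms in \<open>simp_all add: congruence_def\<close>)

lemma Id_on_subset_congruence:
  "congruence A \<theta> \<Longrightarrow> Id_on (carrier A) \<subseteq> \<theta>"
  by (auto simp: Id_on_def congruenceD(1))

lemma nontrivial_congruence:
  assumes "congruence A \<theta>" "\<theta> \<noteq> Id_on (carrier A)"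
  obtains x y where "(x, y) \<in> \<theta>" "x \<noteq> y"
  using assms Id_on_subset_congruence[OF assms(1)] congruenceD(4)[OF assms(1)] by fast

lemma congruence_Id_on:
  assumes "om_closed A"
  shows "congruence A (Id_on (carrier A))"
  using assms unfolding congruence_def om_closed_def
  by (auto simp: equiv_def refl_on_def sym_def trans_def)

text \<open>
  The operations are evaluated at representatives chosen from the classes, so that the definition
  makes sense for every relation; for congruences the choice is immaterial.
\<close>

definition quotient_algebra :: "'a om_algebra \<Rightarrow> 'a rel \<Rightarrow> 'a set om_algebra" where
  "quotient_algebra A \<theta> =
     \<lparr>carrier = carrier A // \<theta>,
      mult = (\<lambda>X Y. \<theta> `` {(SOME a. a \<in> X) \<otimes>\<^bsub>A\<^esub> (SOME b. b \<in> Y)}),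
      one = \<theta> `` {\<one>\<^bsub>A\<^esub>},
      minop = (\<lambda>X Y. \<theta> `` {minop A (SOME a. a \<in> X) (SOME b. b \<in> Y)}),
      maxop = (\<lambda>X Y. \<theta> `` {maxop A (SOME a. a \<in> X) (SOME b. b \<in> Y)})\<rparr>"

lemma quotient_algebra_ops:
  assumes \<theta>: "congruence A \<theta>" and ab: "a \<in> carrier A" "b \<in> carrier A"
  shows "\<theta> `` {a} \<otimes>\<^bsub>quotient_algebra A \<theta>\<^esub> \<theta> `` {b} = \<theta> `` {a \<otimes>\<^bsub>A\<^esub> b}"
    and "minop (quotient_algebra A \<theta>) (\<theta> `` {a}) (\<theta> `` {b}) = \<theta> `` {minop A a b}"
    and "maxop (quotient_algebra A \<theta>) (\<theta> `` {a}) (\<theta> `` {b}) = \<theta> `` {maxop A a b}"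
proof -
  have rep: "(SOME x. x \<in> \<theta> `` {c}, c) \<in> \<theta>" if "c \<in> carrier A" for c
    using someI[of "\<lambda>x. x \<in> \<theta> `` {c}" c] congruenceD(1,2)[OF \<theta>] that by auto
  have "equiv (carrier A) \<theta>" using \<theta> by (simp add: congruence_def)
  note class_eq = equiv_class_eq[OF this]
  show "\<theta> `` {a} \<otimes>\<^bsub>quotient_algebra A \<theta>\<^esub> \<theta> `` {b} = \<theta> `` {a \<otimes>\<^bsub>A\<^esub> b}"
    unfolding quotient_algebra_def monoid.simps
    by (rule class_eq) (intro congruenceD(5)[OF \<theta>] rep ab)
  show "minop (quotient_algebra A \<theta>) (\<theta> `` {a}) (\<theta> `` {b}) = \<theta> `` {minop A a b}"
    unfolding quotient_algebra_def om_algebra.simps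
    by (rule class_eq) (intro congruenceD(6)[OF \<theta>] rep ab)
  show "maxop (quotient_algebra A \<theta>) (\<theta> `` {a}) (\<theta> `` {b}) = \<theta> `` {maxop A a b}"
    unfolding quotient_algebra_def om_algebra.simps
    by (rule class_eq) (intro congruenceD(7)[OF \<theta>] rep ab)
qed

lemma congruence_kernel:
  assumes cl: "om_closed A" and h: "h \<in> om_hom A B"
  shows "congruence A {(a, b). a \<in> carrier A \<and> b \<in> carrier A \<and> h a = h b}"
  using cl h unfolding congruence_def om_closed_def om_hom_def hom_def
  by (auto simp: equiv_def refl_on_def sym_def trans_def)

text \<open>
  Such a pair generates the monolith, the least nontrivial congruence. Asking for the pair rather
  than for the monolith avoids constructing generated congruences.
\<close>

definition has_critical_pair :: "'a om_algebra \<Rightarrow> bool" where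
  "has_critical_pair A \<longleftrightarrow> (\<exists>x\<in>carrier A. \<exists>y\<in>carrier A. x \<noteq> y \<and>
     (\<forall>\<theta>. congruence A \<theta> \<longrightarrow> \<theta> \<noteq> Id_on (carrier A) \<longrightarrow> (x, y) \<in> \<theta>))"

text \<open>
  Without a critical pair, the nontrivial congruences separate points, so the algebra embeds
  subdirectly into the product of the corresponding quotients. None of the projections is injective.
\<close>

lemma critical_pair_if_subdirectly_irreducible:
  assumes cl: "om_closed A" and si: "subdirectly_irreducible A"
  shows "has_critical_pair A"
proof (rule ccontr)
  assume no: "\<not> has_critical_pair A"
  define I where "I = {\<theta>. congruence A \<theta> \<and> \<theta> \<noteq> Id_on (carrier A)}"
  define h where "h a = (\<lambda>\<theta>\<in>I. \<theta> `` {a})" for a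
  have cong: "congruence A \<theta>" if "\<theta> \<in> I" for \<theta> using that by (simp add: I_def)
  have eqv: "equiv (carrier A) \<theta>" if "\<theta> \<in> I" for \<theta>
    using cong[OF that] by (simp add: congruence_def)
  have ops: "a \<otimes>\<^bsub>A\<^esub> b \<in> carrier A" "minop A a b \<in> carrier A" "maxop A a b \<in> carrier A"
    if "a \<in> carrier A" "b \<in> carrier A" for a b
    using cl that by (simp_all add: om_closed_def)
  have one: "\<one>\<^bsub>A\<^esub> \<in> carrier A" using cl by (simp add: om_closed_def)
  have qcar: "carrier (quotient_algebra A \<theta>) = (\<lambda>a. \<theta> `` {a}) ` carrier A" for \<theta>
    by (auto simp: quotient_algebra_def quotient_def)
  have qone: "\<one>\<^bsub>quotient_algebra A \<theta>\<^esub> = \<theta> `` {\<one>\<^bsub>A\<^esub>}" for \<theta>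
    by (simp add: quotient_algebra_def)
  have qcl: "om_closed (quotient_algebra A \<theta>)" if "\<theta> \<in> I" for \<theta>
    unfolding om_closed_def qcar qone
    using one by (auto simp: quotient_algebra_ops[OF cong[OF that]] ops)
  have hom: "h \<in> om_hom A (om_product I (quotient_algebra A))"
    unfolding om_hom_def hom_def om_product_def
    by (auto simp: h_def qcar qone quotient_algebra_ops[OF cong] cong: restrict_cong)
  have inj: "inj_on h (carrier A)"
  proof (rule inj_onI, rule ccontr)
    fix x y assume xy: "x \<in> carrier A" "y \<in> carrier A" "h x = h y" "x \<noteq> y"
    then obtain \<theta> where \<theta>: "\<theta> \<in> I" "(x, y) \<notin> \<theta>"
      using no unfolding has_critical_pair_def I_def by blast
    have "\<theta> `` {x} = \<theta> `` {y}" using fun_cong[OF xy(3), of \<theta>] \<theta>(1) by (simp add: h_def)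
    then show False using \<theta>(2) eq_equiv_class[OF _ eqv[OF \<theta>(1)] xy(2)] by blast
  qed
  have "subdirect_embedding I (quotient_algebra A) A h"
    unfolding subdirect_embedding_def using qcl hom inj by (simp add: h_def qcar)
  then obtain \<theta> where \<theta>: "\<theta> \<in> I" and iso: "(\<lambda>a. h a \<theta>) \<in> om_iso A (quotient_algebra A \<theta>)"
    using si unfolding subdirectly_irreducible_def by blast
  have inj': "inj_on (\<lambda>a. \<theta> `` {a}) (carrier A)"
    using iso \<theta> by (simp add: om_iso_def bij_betw_def h_def)
  obtain x y where xy: "(x, y) \<in> \<theta>" "x \<noteq> y"
    using nontrivial_congruence[of A \<theta>] \<theta> unfolding I_def by blast
  have "\<theta> `` {x} = \<theta> `` {y}" using equiv_class_eq[OF eqv[OF \<theta>] xy(1)] .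
  then show False using inj_onD[OF inj'] congruenceD(4)[OF cong[OF \<theta>] xy(1)] xy(2) by blast
qed

text \<open>
  If no projection is an isomorphism, then every kernel of a projection is nontrivial and contains
  the critical pair, which the embedding then cannot separate.
\<close>

lemma subdirectly_irreducible_if_critical_pair:
  assumes cl: "om_closed A" and cp: "has_critical_pair A"
  shows "subdirectly_irreducible A"
  unfolding subdirectly_irreducible_def
proof (intro allI impI, rule ccontr)
  fix I :: "'a rel set" and B :: "'a rel \<Rightarrow> 'a set om_algebra" and h
  assume emb: "subdirect_embedding I B A h" and no: "\<not> (\<exists>i\<in>I. (\<lambda>a. h a i) \<in> om_iso A (B i))"
  obtain x y where xy: "x \<in> carrier A" "y \<in> carrier A" "x \<noteq> y"
    and crit: "\<And>\<theta>. congruence A \<theta> \<Longrightarrow> \<theta> \<noteq> Id_on (carrier A) \<Longrightarrow> (x, y) \<in> \<theta>"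
    using cp unfolding has_critical_pair_def by blast
  have h: "h \<in> om_hom A (om_product I B)" and inj: "inj_on h (carrier A)"
    and surj: "\<And>i. i \<in> I \<Longrightarrow> (\<lambda>a. h a i) ` carrier A = carrier (B i)"
    using emb unfolding subdirect_embedding_def by auto
  have hom: "(\<lambda>a. h a i) \<in> om_hom A (B i)" if "i \<in> I" for i
    using h that surj[OF that] unfolding om_hom_def hom_def om_product_def by auto
  have "h x i = h y i" for i
  proof (cases "i \<in> I")
    case True
    define K where "K = {(a, b). a \<in> carrier A \<and> b \<in> carrier A \<and> h a i = h b i}"
    have "\<not> inj_on (\<lambda>a. h a i) (carrier A)"
      using no True hom[OF True] surj[OF True] unfolding om_iso_def bij_betw_def by blast
    then have "K \<noteq> Id_on (carrier A)" unfolding K_def inj_on_def Id_on_def by blast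
    then have "(x, y) \<in> K"
      using crit congruence_kernel[OF cl hom[OF True]] unfolding K_def by blast
    then show ?thesis by (simp add: K_def)
  next
    case False
    have "h x \<in> extensional I" "h y \<in> extensional I"
      using h xy(1,2) unfolding om_hom_def hom_def om_product_def PiE_def by auto
    then show ?thesis using False extensional_arb by metis
  qed
  then have "h x = h y" by (rule ext)
  then show False using inj_onD[OF inj] xy by blast
qed

text \<open>
  A nontrivial congruence comparable with the atom contains it, so any two distinct elements related
  by the atom are critical.
\<close>

lemma critical_pair_if_chain_with_atom:
  assumes cl: "om_closed A" and chain: "chain\<^sub>\<subseteq> (Con A)" and atom: "atom_of (Con A) \<alpha>"
  shows "has_critical_pair A"
proof -
  let ?Id = "Id_on (carrier A)"
  have "?Id \<in> Con A" using congruence_Id_on[OF cl] by (simp add: Con_def)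
  then have least: "\<beta> = ?Id" if "\<beta> \<in> Con A" "\<forall>\<gamma>\<in>Con A. \<beta> \<subseteq> \<gamma>" for \<beta>
    using that Id_on_subset_congruence[of A \<beta>] unfolding Con_def by blast
  obtain \<beta> where \<beta>: "\<beta> \<in> Con A" "\<forall>\<gamma>\<in>Con A. \<beta> \<subseteq> \<gamma>" and \<alpha>: "\<alpha> \<in> Con A" "\<beta> \<subset> \<alpha>"
    and min: "\<not> (\<exists>\<gamma>\<in>Con A. \<beta> \<subset> \<gamma> \<and> \<gamma> \<subset> \<alpha>)"
    using atom unfolding atom_of_def by (elim conjE bexE)
  note \<beta>_eq = least[OF \<beta>]
  have "congruence A \<alpha>" "\<alpha> \<noteq> ?Id" using \<alpha> \<beta>_eq by (auto simp: Con_def)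
  then obtain x y where xy: "(x, y) \<in> \<alpha>" "x \<noteq> y" by (rule nontrivial_congruence)
  have "\<alpha> \<subseteq> \<theta>" if "congruence A \<theta>" "\<theta> \<noteq> ?Id" for \<theta>
  proof -
    have \<theta>: "\<theta> \<in> Con A" "\<beta> \<subset> \<theta>"
      using that Id_on_subset_congruence[OF that(1)] \<beta>_eq by (auto simp: Con_def)
    then have "\<not> \<theta> \<subset> \<alpha>" using min by blast
    moreover have "\<alpha> \<subseteq> \<theta> \<or> \<theta> \<subseteq> \<alpha>" using chain \<alpha>(1) \<theta>(1) unfolding chain_subset_def by blast
    ultimately show ?thesis by blast
  qed
  then show ?thesis
    using xy congruenceD(4)[of A \<alpha> x y] \<alpha>(1) unfolding has_critical_pair_def Con_def by blast
qed


section \<open>Congruences of ordered monoids with one nontrivial class\<close>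

definition block_relation :: "'a set \<Rightarrow> 'a set \<Rightarrow> 'a rel" where
  "block_relation U X = Id_on U \<union> X \<times> X"

context idempotent_ordered_monoid
begin

lemma leq_refl: "a \<in> carrier A \<Longrightarrow> leq A a a"
  using linear unfolding order_on_defs refl_on_def by blast

lemma leq_total: "a \<in> carrier A \<Longrightarrow> b \<in> carrier A \<Longrightarrow> leq A a b \<or> leq A b a"
  using linear leq_refl unfolding order_on_defs total_on_def by (cases "a = b") auto

lemma leq_antisym: "a \<in> carrier A \<Longrightarrow> b \<in> carrier A \<Longrightarrow> leq A a b \<Longrightarrow> leq A b a \<Longrightarrow> a = b"
  using linear unfolding order_on_defs antisym_def by blast

lemma om_closed: "om_closed A"
  unfolding om_closed_def by (auto simp: minop maxop)

lemma congruence_convex: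
  assumes \<theta>: "congruence A \<theta>" and xy: "(x, y) \<in> \<theta>"
    and z: "z \<in> carrier A" "leq A x z" "leq A z y"
  shows "(x, z) \<in> \<theta>"
proof -
  have c: "x \<in> carrier A" "y \<in> carrier A" using congruenceD(4)[OF \<theta> xy] by auto
  have "minop A y z = z" using minop[OF c(2) z(1)] leq_antisym[OF c(2) z(1)] z(3) by auto
  moreover have "minop A x z = x" using minop[OF c(1) z(1)] z(2) by simp
  ultimately show ?thesis
    using congruenceD(6)[OF \<theta> xy congruenceD(1)[OF \<theta> z(1)]] by simp
qed

text \<open>
  For a total order, collapsing a convex set to a point respects minima and maxima. This leaves the
  translations by elements of the monoid, each of which must either map the set into itself or be
  constant on it; the disjunction may be decided separately for each pair of elements.
\<close>

lemma congruence_block_relation: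
  assumes X: "X \<subseteq> carrier A"
    and convex: "\<And>x y z. x \<in> X \<Longrightarrow> y \<in> X \<Longrightarrow> z \<in> carrier A \<Longrightarrow> leq A x z \<Longrightarrow> leq A z y \<Longrightarrow> z \<in> X"
    and left: "\<And>x y z. x \<in> X \<Longrightarrow> y \<in> X \<Longrightarrow> z \<in> carrier A \<Longrightarrow>
      z \<otimes> x = z \<otimes> y \<or> z \<otimes> x \<in> X \<and> z \<otimes> y \<in> X"
    and right: "\<And>x y z. x \<in> X \<Longrightarrow> y \<in> X \<Longrightarrow> z \<in> carrier A \<Longrightarrow>
      x \<otimes> z = y \<otimes> z \<or> x \<otimes> z \<in> X \<and> y \<otimes> z \<in> X"
  shows "congruence A (block_relation (carrier A) X)" (is "congruence A ?\<theta>")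
proof -
  have iff: "(a, b) \<in> ?\<theta> \<longleftrightarrow> a \<in> carrier A \<and> b \<in> carrier A \<and> (a = b \<or> a \<in> X \<and> b \<in> X)" for a b
    using X by (auto simp: block_relation_def)
  have trans: "(a, c) \<in> ?\<theta>" if "(a, b) \<in> ?\<theta>" "(b, c) \<in> ?\<theta>" for a b c
    using that unfolding iff by blast
  \<comment> \<open>Replacing one argument at a time, it suffices to check translations.\<close>
  have two_sided: "(f a c, f b d) \<in> ?\<theta>"
    if closed: "\<And>u v. u \<in> carrier A \<Longrightarrow> v \<in> carrier A \<Longrightarrow> f u v \<in> carrier A"
      and l: "\<And>x y z. x \<in> X \<Longrightarrow> y \<in> X \<Longrightarrow> z \<in> carrier A \<Longrightarrow> f z x = f z y \<or> f z x \<in> X \<and> f z y \<in> X"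
      and r: "\<And>x y z. x \<in> X \<Longrightarrow> y \<in> X \<Longrightarrow> z \<in> carrier A \<Longrightarrow> f x z = f y z \<or> f x z \<in> X \<and> f y z \<in> X"
      and ab: "(a, b) \<in> ?\<theta>" and cd: "(c, d) \<in> ?\<theta>" for f a b c d
  proof (rule trans)
    show "(f a c, f b c) \<in> ?\<theta>" using ab cd r[of a b c] closed unfolding iff by auto
    show "(f b c, f b d) \<in> ?\<theta>" using ab cd l[of c d b] closed unfolding iff by auto
  qed
  have meet: "minop A x z = minop A y z \<or> minop A x z \<in> X \<and> minop A y z \<in> X"
      "minop A z x = minop A z y \<or> minop A z x \<in> X \<and> minop A z y \<in> X"
    and join: "maxop A x z = maxop A y z \<or> maxop A x z \<in> X \<and> maxop A y z \<in> X"
      "maxop A z x = maxop A z y \<or> maxop A z x \<in> X \<and> maxop A z y \<in> X"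
    if "x \<in> X" "y \<in> X" "z \<in> carrier A" for x y z
  proof -
    have c: "x \<in> carrier A" "y \<in> carrier A" using that X by auto
    note t = leq_total[OF c(1) that(3)] leq_total[OF c(2) that(3)]
      leq_antisym[OF c(1) that(3)] leq_antisym[OF c(2) that(3)]
      convex[OF that] convex[OF that(2,1,3)]
    show "minop A x z = minop A y z \<or> minop A x z \<in> X \<and> minop A y z \<in> X"
      "minop A z x = minop A z y \<or> minop A z x \<in> X \<and> minop A z y \<in> X"
      "maxop A x z = maxop A y z \<or> maxop A x z \<in> X \<and> maxop A y z \<in> X"
      "maxop A z x = maxop A z y \<or> maxop A z x \<in> X \<and> maxop A z y \<in> X"
      unfolding minop[OF c(1) that(3)] minop[OF c(2) that(3)] minop[OF that(3) c(1)]
        minop[OF that(3) c(2)] maxop[OF c(1) that(3)] maxop[OF c(2) that(3)]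
        maxop[OF that(3) c(1)] maxop[OF that(3) c(2)]
      using t that(1,2) by (metis (full_types))+
  qed
  have "equiv (carrier A) ?\<theta>"
    using trans by (intro equivI refl_onI symI transI) (auto simp: iff)
  moreover have "(a \<otimes> c, b \<otimes> d) \<in> ?\<theta>" "(minop A a c, minop A b d) \<in> ?\<theta>"
    "(maxop A a c, maxop A b d) \<in> ?\<theta>" if "(a, b) \<in> ?\<theta>" "(c, d) \<in> ?\<theta>" for a b c d
  proof -
    show "(a \<otimes> c, b \<otimes> d) \<in> ?\<theta>" by (rule two_sided[OF _ left right that]) simp
    show "(minop A a c, minop A b d) \<in> ?\<theta>"
      by (rule two_sided[OF _ meet(2,1) that]) (auto simp: minop)
    show "(maxop A a c, maxop A b d) \<in> ?\<theta>"
      by (rule two_sided[OF _ join(2,1) that]) (auto simp: maxop)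
  qed
  ultimately show ?thesis unfolding congruence_def by blast
qed

end


section \<open>Nested sums of the four components\<close>

lemma carrier_components:
  "carrier C2 = {Bot, E}" "carrier C2d = {E, Top}" "carrier G3 = {Bot, E, Top}"
  "carrier D3 = {Bot, E, Top}"
  by (simp_all add: C2_def C2d_def G3_def D3_def om_of_order_def)

text \<open>
  The two-element component whose non-identity element is \<open>a\<close>; the value at \<open>E\<close> is arbitrary.
\<close>

definition pure_component :: "elt \<Rightarrow> elt om_algebra" where
  "pure_component a = (if a = Bot then C2 else C2d)"

lemma carrier_pure_component: "a \<noteq> E \<Longrightarrow> carrier (pure_component a) = {a, E}"
  by (cases a) (auto simp: pure_component_def carrier_components)

definition separated :: "'c set \<Rightarrow> 'c rel \<Rightarrow> ('c \<Rightarrow> elt om_algebra) \<Rightarrow> bool" where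
  "separated C r M \<longleftrightarrow> (\<forall>d1\<in>C. \<forall>d2\<in>C.
     (d1, d2) \<in> r \<and> d1 \<noteq> d2 \<and> M d1 = M d2 \<and> M d1 \<in> {C2, C2d} \<longrightarrow>
     (\<exists>b\<in>C. (d1, b) \<in> r \<and> d1 \<noteq> b \<and> (b, d2) \<in> r \<and> b \<noteq> d2 \<and> M b \<noteq> M d1))"

context
  fixes C :: "'c set" and r :: "'c rel" and M :: "'c \<Rightarrow> elt om_algebra"
  assumes C: "linear_order_on C r" and M: "\<And>c. c \<in> C \<Longrightarrow> M c \<in> {C2, C2d, G3, D3}"
begin

abbreviation (input) nsum :: "('c \<times> elt) option om_algebra" where
  "nsum \<equiv> nested_sum C r M"

lemma chain_order:
  "c \<in> C \<Longrightarrow> (c, c) \<in> r"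
  "(c, d) \<in> r \<Longrightarrow> (d, c) \<in> r \<Longrightarrow> c = d"
  "(c, d) \<in> r \<Longrightarrow> (d, k) \<in> r \<Longrightarrow> (c, k) \<in> r"
  "c \<in> C \<Longrightarrow> d \<in> C \<Longrightarrow> (c, d) \<in> r \<or> (d, c) \<in> r"
  "(c, d) \<in> r \<Longrightarrow> c \<in> C \<and> d \<in> C"
proof -
  have R: "refl_on C r" "r \<subseteq> C \<times> C" "trans r" "antisym r" "total_on C r"
    using C unfolding order_on_defs by simp_all
  show refl: "c \<in> C \<Longrightarrow> (c, c) \<in> r" for c by (rule refl_onD[OF R(1)])
  show "(c, d) \<in> r \<Longrightarrow> (d, c) \<in> r \<Longrightarrow> c = d" by (rule antisymD[OF R(4)])
  show "(c, d) \<in> r \<Longrightarrow> (d, k) \<in> r \<Longrightarrow> (c, k) \<in> r" by (rule transD[OF R(3)])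
  show "c \<in> C \<Longrightarrow> d \<in> C \<Longrightarrow> (c, d) \<in> r \<or> (d, c) \<in> r"
    using R(5) refl unfolding total_on_def by (cases "c = d") auto
  show "(c, d) \<in> r \<Longrightarrow> c \<in> C \<and> d \<in> C" using R(2) by blast
qed

lemma idempotent_ordered_monoid_nsum: "idempotent_ordered_monoid nsum"
  by (rule nested_sum_idempotent_ordered_monoid[OF C])
    (rule components_idempotent_ordered_monoid[OF M])

interpretation N: idempotent_ordered_monoid nsum
  by (rule idempotent_ordered_monoid_nsum)

lemma component_simps:
  assumes "c \<in> C"
  shows "\<one>\<^bsub>M c\<^esub> = E"
    and "a \<noteq> E \<Longrightarrow> b \<noteq> E \<Longrightarrow> a \<otimes>\<^bsub>M c\<^esub> b = (if M c = D3 then b else a)"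
    and "a \<in> carrier (M c) \<Longrightarrow> leq (M c) a b \<longleftrightarrow> elt_le a b"
proof -
  have "mult C2 = mult_left" "mult C2d = mult_left" "mult G3 = mult_left" "mult D3 = mult_right"
    by (simp_all add: C2_def C2d_def G3_def D3_def om_of_order_def)
  moreover have "mult_left Bot Top \<noteq> mult_right Bot Top" by (simp add: mult_left_def mult_right_def)
  ultimately have ne: "C2 \<noteq> D3" "C2d \<noteq> D3" "G3 \<noteq> D3" by auto
  show "\<one>\<^bsub>M c\<^esub> = E"
    using M[OF assms] by (auto simp: C2_def C2d_def G3_def D3_def om_of_order_def)
  show "a \<noteq> E \<Longrightarrow> b \<noteq> E \<Longrightarrow> a \<otimes>\<^bsub>M c\<^esub> b = (if M c = D3 then b else a)"
    using M[OF assms] ne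
    by (auto simp: C2_def C2d_def G3_def D3_def om_of_order_def mult_left_def mult_right_def)
  have refl: "elt_le a a" by (cases a) simp_all
  show "a \<in> carrier (M c) \<Longrightarrow> leq (M c) a b \<longleftrightarrow> elt_le a b"
    using M[OF assms] refl by (auto simp: C2_def C2d_def G3_def D3_def om_of_order_def leq_def)
qed

lemma component_pure_iff:
  assumes c: "c \<in> C" and a: "a \<noteq> E"
  shows "M c = pure_component a \<longleftrightarrow> (\<forall>b\<in>carrier (M c) - {E}. b = a)"
proof -
  have "C2 \<noteq> C2d" "C2 \<noteq> G3" "C2 \<noteq> D3" "C2d \<noteq> G3" "C2d \<noteq> D3"
    using carrier_components by auto
  then show ?thesis
    using M[OF c] a by (cases a) (auto simp: pure_component_def carrier_components)
qed

lemma component_nontrivial: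
  assumes "c \<in> C"
  obtains a where "a \<in> carrier (M c)" "a \<noteq> E"
proof -
  have "Bot \<in> carrier (M c) \<or> Top \<in> carrier (M c)"
    using M[OF assms] by (auto simp: carrier_components)
  then show thesis using that[of Bot] that[of Top] by blast
qed

lemma carrier_nsum [simp]:
  "None \<in> carrier nsum"
  "Some (c, a) \<in> carrier nsum \<longleftrightarrow> c \<in> C \<and> a \<in> carrier (M c) \<and> a \<noteq> E"
  by (auto simp: nested_sum_def om_of_order_def nested_carrier_def emb_def component_simps(1)
      split: if_splits)

lemma mult_nsum:
  "None \<otimes>\<^bsub>nsum\<^esub> x = x"
  "x \<otimes>\<^bsub>nsum\<^esub> None = x"
  "Some (c, a) \<in> carrier nsum \<Longrightarrow> Some (d, b) \<in> carrier nsum \<Longrightarrow>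
     Some (c, a) \<otimes>\<^bsub>nsum\<^esub> Some (d, b) =
       (if c = d then Some (c, if M c = D3 then b else a)
        else if (c, d) \<in> r then Some (c, a) else Some (d, b))"
proof -
  have mult: "x \<otimes>\<^bsub>nsum\<^esub> y = nested_mult r M x y" for x y
    by (simp add: nested_sum_def om_of_order_def)
  show "None \<otimes>\<^bsub>nsum\<^esub> x = x" by (simp add: mult)
  show "x \<otimes>\<^bsub>nsum\<^esub> None = x" by (cases x) (simp_all add: mult)
  show "Some (c, a) \<in> carrier nsum \<Longrightarrow> Some (d, b) \<in> carrier nsum \<Longrightarrow>
     Some (c, a) \<otimes>\<^bsub>nsum\<^esub> Some (d, b) =
       (if c = d then Some (c, if M c = D3 then b else a)
        else if (c, d) \<in> r then Some (c, a) else Some (d, b))"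
    by (auto simp: mult emb_def component_simps)
qed

text \<open>
  Every negative element lies below the identity and every positive one above it. Along the chain,
  the negative elements increase and the positive ones decrease.
\<close>

lemma nested_le_elt:
  assumes "nested_le C r M x y"
  shows "case (x, y) of
      (None, None) \<Rightarrow> True
    | (Some (c, a), None) \<Rightarrow> a = Bot
    | (None, Some (d, b)) \<Rightarrow> b = Top
    | (Some (c, a), Some (d, b)) \<Rightarrow>
        a = Bot \<and> b = Top \<or> a = Bot \<and> b = Bot \<and> (c, d) \<in> r \<or> a = Top \<and> b = Top \<and> (d, c) \<in> r"
  using assms
proof cases
  case (component c a b)
  then show ?thesis
    using component_simps[of c] chain_order(1)[of c] by (cases a; cases b) (auto simp: emb_def)
next
  case (below c d a b)
  then show ?thesis
    using component_simps[of c] component_simps(1)[of d] by (cases a; cases b) (auto simp: emb_def)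
next
  case (above c d a b)
  then show ?thesis
    using component_simps[of c] component_simps(1)[of d] M[of c]
    by (cases a; cases b)
      (auto simp: emb_def component_simps C2_def C2d_def G3_def D3_def om_of_order_def leq_def)
qed simp

lemma leq_nsum:
  assumes "x \<in> carrier nsum" "y \<in> carrier nsum" "leq nsum x y"
  shows "nested_le C r M x y"
proof -
  have "nested_le C r M x y" if "x \<noteq> y"
    using assms(3) that by (simp add: leq_def nested_sum_def om_of_order_def split: if_splits)
  moreover have "nested_le C r M x x"
  proof (cases x)
    case None
    then show ?thesis by (simp add: nested_le.unit)
  next
    case (Some p)
    then obtain c a where x: "x = Some (c, a)" by (cases p) auto
    have "elt_le a a" by (cases a) simp_all
    then have "nested_le C r M (emb M c a) (emb M c a)"
      using assms(1) x by (intro nested_le.component) (simp_all add: component_simps)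
    then show ?thesis using assms(1) x by (simp add: emb_def component_simps)
  qed
  ultimately show ?thesis by blast
qed

lemma leq_nsum_None:
  assumes "Some (c, a) \<in> carrier nsum"
  shows "a = Bot \<Longrightarrow> leq nsum (Some (c, a)) None"
    and "a = Top \<Longrightarrow> leq nsum None (Some (c, a))"
  using N.leq_total[OF assms carrier_nsum(1)]
    nested_le_elt[OF leq_nsum[OF assms carrier_nsum(1)]]
    nested_le_elt[OF leq_nsum[OF carrier_nsum(1) assms]] by auto

text \<open>
  The identity lies between the two elements, and congruence classes are convex.
\<close>

lemma related_opposite_signs:
  assumes \<theta>: "congruence nsum \<theta>" and xy: "(Some (c, a), Some (d, b)) \<in> \<theta>" and ne: "a \<noteq> b"
  shows "(Some (c, a), None) \<in> \<theta>"
proof -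
  have car: "Some (c, a) \<in> carrier nsum" "Some (d, b) \<in> carrier nsum"
    using congruenceD(4)[OF \<theta> xy] by blast+
  then consider "a = Bot" "b = Top" | "a = Top" "b = Bot"
    using ne by (cases a; cases b) auto
  then show ?thesis
  proof cases
    case 1
    show ?thesis
      using N.congruence_convex[OF \<theta> xy carrier_nsum(1)] leq_nsum_None car 1 by blast
  next
    case 2
    have "(Some (d, b), None) \<in> \<theta>"
      using N.congruence_convex[OF \<theta> congruenceD(2)[OF \<theta> xy] carrier_nsum(1)]
        leq_nsum_None car 2 by blast
    then show ?thesis using congruenceD(3)[OF \<theta> xy] by blast
  qed
qed

text \<open>
  The element \<open>x\<close> in component \<open>c\<close> absorbs the element \<open>y\<close> in component \<open>d\<close> from at least one side,
  so replacing \<open>x\<close> by the identity in the product relates \<open>x\<close> to \<open>y\<close>.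
\<close>

lemma unit_class_up_closed:
  assumes \<theta>: "congruence nsum \<theta>" and x: "(Some (c, a), None) \<in> \<theta>"
    and cd: "(c, d) \<in> r" and y: "Some (d, b) \<in> carrier nsum"
  shows "(Some (d, b), None) \<in> \<theta>"
proof -
  let ?x = "Some (c, a)" and ?y = "Some (d, b)"
  have cx: "?x \<in> carrier nsum" using congruenceD(4)[OF \<theta> x] by blast
  have yy: "(?y, ?y) \<in> \<theta>" using congruenceD(1)[OF \<theta> y] .
  have "?x \<otimes>\<^bsub>nsum\<^esub> ?y = ?x \<or> ?y \<otimes>\<^bsub>nsum\<^esub> ?x = ?x"
    using cd mult_nsum(3)[OF cx y] mult_nsum(3)[OF y cx] by (auto split: if_splits)
  then have "(?x, ?y) \<in> \<theta>"
    using congruenceD(5)[OF \<theta> x yy] congruenceD(5)[OF \<theta> yy x] by (auto simp: mult_nsum(1,2))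
  then show ?thesis using congruenceD(2,3)[OF \<theta>] x by blast
qed

text \<open>
  An element of the opposite sign in between is absorbed by the lower of the two elements and absorbs
  the upper one. At the ends of the interval this holds for multiplication from one side only: a
  product of two non-identity elements of one component is its left factor, or its right factor in
  \<open>D3\<close>.
\<close>

lemma related_same_sign:
  assumes \<theta>: "congruence nsum \<theta>" and xy: "(Some (c, a), Some (d, a)) \<in> \<theta>" and ne: "c \<noteq> d"
    and z: "Some (k, b) \<in> carrier nsum" "b \<noteq> a" and ck: "(c, k) \<in> r" and kd: "(k, d) \<in> r"
  shows "(Some (c, a), None) \<in> \<theta>"
proof -
  let ?x = "Some (c, a)" and ?y = "Some (d, a)" and ?z = "Some (k, b)"
  have cx: "?x \<in> carrier nsum" and cy: "?y \<in> carrier nsum"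
    using congruenceD(4)[OF \<theta> xy] by blast+
  have zz: "(?z, ?z) \<in> \<theta>" using congruenceD(1)[OF \<theta> z(1)] .
  have order: "(k, c) \<in> r \<Longrightarrow> k = c" "(d, k) \<in> r \<Longrightarrow> k = d"
    using chain_order(2) ck kd by blast+
  have "?z \<otimes>\<^bsub>nsum\<^esub> ?x = ?x \<and> ?z \<otimes>\<^bsub>nsum\<^esub> ?y = ?z \<or>
      ?x \<otimes>\<^bsub>nsum\<^esub> ?z = ?x \<and> ?y \<otimes>\<^bsub>nsum\<^esub> ?z = ?z"
    unfolding mult_nsum(3)[OF z(1) cx] mult_nsum(3)[OF z(1) cy]
      mult_nsum(3)[OF cx z(1)] mult_nsum(3)[OF cy z(1)]
    using ne order ck kd by auto
  then have "(?x, ?z) \<in> \<theta>"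
    using congruenceD(5)[OF \<theta> zz xy] congruenceD(5)[OF \<theta> xy zz] by auto
  then show ?thesis using related_opposite_signs[OF \<theta>] z(2) by blast
qed

text \<open>
  If the class avoids the identity, then all components between \<open>c\<close> and \<open>d\<close> have elements of one
  sign only and are therefore equal, which separation forbids.
\<close>

lemma separated_related_ordered:
  assumes sep: "separated C r M" and \<theta>: "congruence nsum \<theta>"
    and xy: "(Some (c, a), Some (d, a)) \<in> \<theta>" and cd: "(c, d) \<in> r" "c \<noteq> d"
  shows "(Some (c, a), None) \<in> \<theta>"
proof (rule ccontr)
  assume no: "(Some (c, a), None) \<notin> \<theta>"
  have a: "a \<noteq> E" using congruenceD(4)[OF \<theta> xy] by simp
  have pure: "M k = pure_component a" if "(c, k) \<in> r" "(k, d) \<in> r" for k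
    using component_pure_iff[of k a] related_same_sign[OF \<theta> xy cd(2) _ _ that] no a
      chain_order(5)[OF that(1)] by auto
  have "c \<in> C" "d \<in> C" using chain_order(5)[OF cd(1)] by simp_all
  moreover from this have "M c = pure_component a" "M d = pure_component a"
    using pure chain_order(1) cd(1) by blast+
  moreover have "pure_component a \<in> {C2, C2d}" by (simp add: pure_component_def)
  ultimately obtain b where "(c, b) \<in> r" "(b, d) \<in> r" "M b \<noteq> M c"
    using sep cd unfolding separated_def by metis
  then show False using pure \<open>M c = pure_component a\<close> by simp
qed

lemma separated_related_to_unit:
  assumes sep: "separated C r M" and \<theta>: "congruence nsum \<theta>" and xy: "(x, y) \<in> \<theta>" "x \<noteq> y"
  shows "(x, None) \<in> \<theta>"
proof (cases x)
  case None
  then show ?thesis using congruenceD(1)[OF \<theta>] by simp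
next
  case x: (Some p)
  obtain c a where p: "p = (c, a)" by fastforce
  show ?thesis
  proof (cases y)
    case None
    then show ?thesis using xy by simp
  next
    case y: (Some q)
    obtain d b where q: "q = (d, b)" by fastforce
    have xy': "(Some (c, a), Some (d, b)) \<in> \<theta>" using xy x y p q by simp
    note yx' = congruenceD(2)[OF \<theta> xy']
    show ?thesis
    proof (cases "a = b")
      case False
      then show ?thesis using related_opposite_signs[OF \<theta> xy'] x p by simp
    next
      case True
      then have ne: "c \<noteq> d" using xy x y p q by simp
      have "c \<in> C" "d \<in> C" using congruenceD(4)[OF \<theta> xy'] by simp_all
      then consider "(c, d) \<in> r" | "(d, c) \<in> r" using chain_order(4) by blast
      then show ?thesis
      proof cases
        case 1
        then show ?thesis using separated_related_ordered[OF sep \<theta>] xy' True ne x p by blast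
      next
        case 2
        then have "(Some (d, b), None) \<in> \<theta>"
          using separated_related_ordered[OF sep \<theta>] yx' True ne by blast
        then show ?thesis using congruenceD(3)[OF \<theta> xy'] x p by simp
      qed
    qed
  qed
qed

lemma separated_related_iff:
  assumes sep: "separated C r M" and \<theta>: "congruence nsum \<theta>"
  shows "(x, y) \<in> \<theta> \<longleftrightarrow> x \<in> carrier nsum \<and> x = y \<or> (x, None) \<in> \<theta> \<and> (y, None) \<in> \<theta>"
  using separated_related_to_unit[OF sep \<theta>] congruenceD(1-4)[OF \<theta>] by metis

text \<open>
  Congruences are compared through their identity classes, which are up-sets of a chain.
\<close>

lemma chain_congruences_if_separated:
  assumes sep: "separated C r M"
  shows "chain\<^sub>\<subseteq> (Con nsum)"
  unfolding chain_subset_def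
proof (intro ballI)
  fix \<theta> \<phi> assume "\<theta> \<in> Con nsum" "\<phi> \<in> Con nsum"
  then have \<theta>: "congruence nsum \<theta>" and \<phi>: "congruence nsum \<phi>" by (simp_all add: Con_def)
  note iff = separated_related_iff[OF sep]
  show "\<theta> \<subseteq> \<phi> \<or> \<phi> \<subseteq> \<theta>"
  proof (rule disjCI)
    assume "\<not> \<phi> \<subseteq> \<theta>"
    then obtain w where w: "(w, None) \<in> \<phi>" "(w, None) \<notin> \<theta>"
      using iff[OF \<theta>] iff[OF \<phi>] congruenceD(4)[OF \<phi>] by (metis subrelI)
    then obtain c a where ca: "w = Some (c, a)"
      using congruenceD(1)[OF \<theta>] carrier_nsum(1) by (cases w) auto
    have wc: "Some (c, a) \<in> carrier nsum" using congruenceD(4)[OF \<phi> w(1)] ca by simp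
    have sub: "(u, None) \<in> \<phi>" if u: "(u, None) \<in> \<theta>" for u
    proof (cases u)
      case None
      then show ?thesis using congruenceD(1)[OF \<phi>] by simp
    next
      case (Some p)
      then obtain d b where db: "u = Some (d, b)" by (cases p) auto
      have uc: "Some (d, b) \<in> carrier nsum" using congruenceD(4)[OF \<theta> u] db by simp
      have "(d, c) \<notin> r" using unit_class_up_closed[OF \<theta> _ _ wc] u w(2) db ca by blast
      then have "(c, d) \<in> r" using chain_order(4)[of c d] wc uc by simp
      then show ?thesis using unit_class_up_closed[OF \<phi> _ _ uc] w(1) db ca by blast
    qed
    show "\<theta> \<subseteq> \<phi>"
      using iff[OF \<theta>] iff[OF \<phi>] sub by (metis subrelI)
  qed
qed

definition upper_block :: "'c \<Rightarrow> ('c \<times> elt) option set" where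
  "upper_block d = {None} \<union> {Some (k, b) |k b. (d, k) \<in> r \<and> Some (k, b) \<in> carrier nsum}"

lemma upper_block_iff:
  "None \<in> upper_block d"
  "Some (k, b) \<in> upper_block d \<longleftrightarrow> (d, k) \<in> r \<and> Some (k, b) \<in> carrier nsum"
  by (auto simp: upper_block_def)

text \<open>
  An element outside the block lies in a component below the block and absorbs all of it, so
  translations by such elements are constant on the block.
\<close>

lemma congruence_upper_block:
  "congruence nsum (block_relation (carrier nsum) (upper_block d))"
proof (rule N.congruence_block_relation)
  show sub: "upper_block d \<subseteq> carrier nsum" by (auto simp: upper_block_def)
  show "z \<in> upper_block d"
    if x: "x \<in> upper_block d" and y: "y \<in> upper_block d" and z: "z \<in> carrier nsum"
      and xz: "leq nsum x z" and zy: "leq nsum z y" for x y z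
  proof (cases z)
    case None
    then show ?thesis by (simp add: upper_block_iff)
  next
    case (Some p)
    obtain k b where p: "p = (k, b)" by fastforce
    have "nested_le C r M x z" "nested_le C r M z y"
      using leq_nsum xz zy z x y sub by blast+
    note le = nested_le_elt[OF this(1)] nested_le_elt[OF this(2)]
    have "(d, k) \<in> r"
      using le z x y Some p chain_order(3)[of d _ k]
      by (auto simp: upper_block_iff split: option.splits prod.splits)
    then show ?thesis using z Some p by (simp add: upper_block_iff)
  qed
  have inside: "z \<otimes>\<^bsub>nsum\<^esub> x \<in> upper_block d" if "z \<in> upper_block d" "x \<in> upper_block d" for x z
  proof (cases "z = None \<or> x = None")
    case True
    then show ?thesis using that by (auto simp: mult_nsum(1,2))
  next
    case False
    then obtain k b l e where "z = Some (k, b)" "x = Some (l, e)" by auto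
    then show ?thesis using that by (auto simp: upper_block_iff mult_nsum(3))
  qed
  have outside: "z \<otimes>\<^bsub>nsum\<^esub> x = z \<and> x \<otimes>\<^bsub>nsum\<^esub> z = z"
    if z: "z \<in> carrier nsum" "z \<notin> upper_block d" and x: "x \<in> upper_block d" for x z
  proof (cases x)
    case None
    then show ?thesis by (simp add: mult_nsum(1,2))
  next
    case (Some p)
    obtain l e where p: "p = (l, e)" by fastforce
    obtain k b where zk: "z = Some (k, b)" using z(2) upper_block_iff(1) by (cases z) auto
    have l: "(d, l) \<in> r" and lc: "Some (l, e) \<in> carrier nsum" using x Some p by (simp_all add: upper_block_iff)
    have k: "(d, k) \<notin> r" and kc: "Some (k, b) \<in> carrier nsum" using z zk by (simp_all add: upper_block_iff)
    have "(l, k) \<notin> r" using k l chain_order(3) by blast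
    moreover from this have "(k, l) \<in> r" "k \<noteq> l"
      using chain_order(1,4) kc lc by auto
    ultimately show ?thesis
      using mult_nsum(3)[OF kc lc] mult_nsum(3)[OF lc kc] zk Some p by simp
  qed
  show "z \<otimes>\<^bsub>nsum\<^esub> x = z \<otimes>\<^bsub>nsum\<^esub> y \<or> z \<otimes>\<^bsub>nsum\<^esub> x \<in> upper_block d \<and> z \<otimes>\<^bsub>nsum\<^esub> y \<in> upper_block d"
    and "x \<otimes>\<^bsub>nsum\<^esub> z = y \<otimes>\<^bsub>nsum\<^esub> z \<or> x \<otimes>\<^bsub>nsum\<^esub> z \<in> upper_block d \<and> y \<otimes>\<^bsub>nsum\<^esub> z \<in> upper_block d"
    if "x \<in> upper_block d" "y \<in> upper_block d" "z \<in> carrier nsum" for x y z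
    using that inside outside by (cases "z \<in> upper_block d"; simp)+
qed

lemma upper_block_nontrivial:
  assumes "d \<in> C"
  shows "block_relation (carrier nsum) (upper_block d) \<noteq> Id_on (carrier nsum)"
proof -
  obtain a where "a \<in> carrier (M d)" "a \<noteq> E" using component_nontrivial[OF assms] .
  then have "Some (d, a) \<in> upper_block d" using assms chain_order(1) by (simp add: upper_block_iff)
  then have "(None, Some (d, a)) \<in> block_relation (carrier nsum) (upper_block d)"
    by (simp add: block_relation_def upper_block_iff)
  then show ?thesis by blast
qed

definition interval_block :: "elt \<Rightarrow> 'c \<Rightarrow> 'c \<Rightarrow> ('c \<times> elt) option set" where
  "interval_block a c d = {Some (k, a) |k. (c, k) \<in> r \<and> (k, d) \<in> r}"

text \<open>
  An element outside the block either absorbs all of the block, if it comes from a component below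
  the interval, or acts on it as the identity. The hypothesis on the components ensures that there
  is no element of the opposite sign inside the interval.
\<close>

lemma congruence_interval_block:
  assumes a: "a \<noteq> E" and pure: "\<And>k. (c, k) \<in> r \<Longrightarrow> (k, d) \<in> r \<Longrightarrow> M k = pure_component a"
  shows "congruence nsum (block_relation (carrier nsum) (interval_block a c d))"
proof (rule N.congruence_block_relation)
  let ?X = "interval_block a c d"
  have iff: "x \<in> ?X \<longleftrightarrow> (\<exists>k. x = Some (k, a) \<and> (c, k) \<in> r \<and> (k, d) \<in> r)" for x
    by (auto simp: interval_block_def)
  show sub: "?X \<subseteq> carrier nsum"
    using chain_order(5) pure a by (auto simp: iff carrier_pure_component)
  show "z \<in> ?X"
    if x: "x \<in> ?X" and y: "y \<in> ?X" and z: "z \<in> carrier nsum"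
      and xz: "leq nsum x z" and zy: "leq nsum z y" for x y z
  proof -
    obtain k l where k: "x = Some (k, a)" "(c, k) \<in> r" "(k, d) \<in> r"
      and l: "y = Some (l, a)" "(c, l) \<in> r" "(l, d) \<in> r"
      using x y iff by blast
    have "nested_le C r M x z" "nested_le C r M z y"
      using leq_nsum xz zy z x y sub by blast+
    note le = nested_le_elt[OF this(1)] nested_le_elt[OF this(2)]
    have "\<exists>j. z = Some (j, a) \<and> ((k, j) \<in> r \<and> (j, l) \<in> r \<or> (l, j) \<in> r \<and> (j, k) \<in> r)"
      using le k(1) l(1) by (auto split: option.splits prod.splits)
    then show ?thesis using k(2,3) l(2,3) chain_order(3) unfolding iff by blast
  qed
  have inside: "z \<otimes>\<^bsub>nsum\<^esub> x \<in> ?X" if zx: "z \<in> ?X" "x \<in> ?X" for x z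
  proof -
    obtain k l where k: "z = Some (k, a)" "(c, k) \<in> r" "(k, d) \<in> r"
      and l: "x = Some (l, a)" "(c, l) \<in> r" "(l, d) \<in> r"
      using zx iff by blast
    have "Some (k, a) \<in> carrier nsum" "Some (l, a) \<in> carrier nsum" using zx sub k(1) l(1) by blast+
    then show ?thesis using k l by (simp add: iff mult_nsum(3))
  qed
  have outside: "(\<forall>x\<in>?X. z \<otimes>\<^bsub>nsum\<^esub> x = z \<and> x \<otimes>\<^bsub>nsum\<^esub> z = z) \<or>
      (\<forall>x\<in>?X. z \<otimes>\<^bsub>nsum\<^esub> x = x \<and> x \<otimes>\<^bsub>nsum\<^esub> z = x)"
    if z: "z \<in> carrier nsum" "z \<notin> ?X" for z
  proof (cases z)
    case None
    then show ?thesis by (simp add: mult_nsum(1,2))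
  next
    case (Some p)
    obtain k b where "p = (k, b)" by fastforce
    then have zk: "z = Some (k, b)" using Some by simp
    have kb: "k \<in> C" "b \<in> carrier (M k)" "b \<noteq> E" using z(1) zk by simp_all
    have "\<not> ((c, k) \<in> r \<and> (k, d) \<in> r)"
      using pure[of k] kb a z(2) zk by (auto simp: iff carrier_pure_component)
    then consider "(c, k) \<notin> r" | "(k, d) \<notin> r" by blast
    then show ?thesis
    proof cases
      case 1
      have "z \<otimes>\<^bsub>nsum\<^esub> x = z \<and> x \<otimes>\<^bsub>nsum\<^esub> z = z" if xX: "x \<in> ?X" for x
      proof -
        obtain l where l: "x = Some (l, a)" "(c, l) \<in> r" using xX by (auto simp: iff)
        have "(l, k) \<notin> r" "k \<noteq> l" using 1 l(2) chain_order(3) by blast+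
        moreover from this have "(k, l) \<in> r"
          using chain_order(4)[of k l] kb(1) chain_order(5)[OF l(2)] by blast
        moreover have "Some (l, a) \<in> carrier nsum" "Some (k, b) \<in> carrier nsum"
          using xX sub l(1) z(1) zk by blast+
        ultimately show ?thesis
          using mult_nsum(3)[of k b l a] mult_nsum(3)[of l a k b] zk l(1) by simp
      qed
      then show ?thesis by blast
    next
      case 2
      have "z \<otimes>\<^bsub>nsum\<^esub> x = x \<and> x \<otimes>\<^bsub>nsum\<^esub> z = x" if xX: "x \<in> ?X" for x
      proof -
        obtain l where l: "x = Some (l, a)" "(l, d) \<in> r" using xX by (auto simp: iff)
        have "(k, l) \<notin> r" "k \<noteq> l" using 2 l(2) chain_order(3) by blast+
        moreover from this have "(l, k) \<in> r"
          using chain_order(4)[of k l] kb(1) chain_order(5)[OF l(2)] by blast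
        moreover have "Some (l, a) \<in> carrier nsum" "Some (k, b) \<in> carrier nsum"
          using xX sub l(1) z(1) zk by blast+
        ultimately show ?thesis
          using mult_nsum(3)[of k b l a] mult_nsum(3)[of l a k b] zk l(1) by simp
      qed
      then show ?thesis by blast
    qed
  qed
  show "z \<otimes>\<^bsub>nsum\<^esub> x = z \<otimes>\<^bsub>nsum\<^esub> y \<or> z \<otimes>\<^bsub>nsum\<^esub> x \<in> ?X \<and> z \<otimes>\<^bsub>nsum\<^esub> y \<in> ?X"
    and "x \<otimes>\<^bsub>nsum\<^esub> z = y \<otimes>\<^bsub>nsum\<^esub> z \<or> x \<otimes>\<^bsub>nsum\<^esub> z \<in> ?X \<and> y \<otimes>\<^bsub>nsum\<^esub> z \<in> ?X"
    if xyz: "x \<in> ?X" "y \<in> ?X" "z \<in> carrier nsum" for x y z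
  proof -
    have "z \<in> ?X \<or> (\<forall>x\<in>?X. z \<otimes>\<^bsub>nsum\<^esub> x = z \<and> x \<otimes>\<^bsub>nsum\<^esub> z = z) \<or>
      (\<forall>x\<in>?X. z \<otimes>\<^bsub>nsum\<^esub> x = x \<and> x \<otimes>\<^bsub>nsum\<^esub> z = x)" using outside[OF xyz(3)] by blast
    then show "z \<otimes>\<^bsub>nsum\<^esub> x = z \<otimes>\<^bsub>nsum\<^esub> y \<or> z \<otimes>\<^bsub>nsum\<^esub> x \<in> ?X \<and> z \<otimes>\<^bsub>nsum\<^esub> y \<in> ?X"
      "x \<otimes>\<^bsub>nsum\<^esub> z = y \<otimes>\<^bsub>nsum\<^esub> z \<or> x \<otimes>\<^bsub>nsum\<^esub> z \<in> ?X \<and> y \<otimes>\<^bsub>nsum\<^esub> z \<in> ?X"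
      using inside xyz(1,2) by (elim disjE; simp)+
  qed
qed

lemma critical_pair_in_upper_block:
  assumes crit: "\<And>\<theta>. congruence nsum \<theta> \<Longrightarrow> \<theta> \<noteq> Id_on (carrier nsum) \<Longrightarrow> (x, y) \<in> \<theta>"
    and ne: "x \<noteq> y" and d: "d \<in> C"
  shows "x \<in> upper_block d" "y \<in> upper_block d"
  using crit[OF congruence_upper_block upper_block_nontrivial[OF d]] ne
  by (auto simp: block_relation_def)

text \<open>
  A critical pair consists of elements of every principal up-set of components, but no component
  lies in all of these when each has one strictly above it.
\<close>

lemma maximal_if_critical_pair:
  assumes "has_critical_pair nsum"
  shows "\<exists>m\<in>C. \<forall>c\<in>C. (m, c) \<in> r \<longrightarrow> c = m"
proof (rule ccontr)
  assume no: "\<not> ?thesis"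
  obtain x y where xy: "x \<in> carrier nsum" "y \<in> carrier nsum" "x \<noteq> y"
    and crit: "\<And>\<theta>. congruence nsum \<theta> \<Longrightarrow> \<theta> \<noteq> Id_on (carrier nsum) \<Longrightarrow> (x, y) \<in> \<theta>"
    using assms unfolding has_critical_pair_def by blast
  obtain c a where ca: "c \<in> C" "Some (c, a) \<in> {x, y}"
    using xy by (cases x; cases y) fastforce+
  obtain d where d: "d \<in> C" "(c, d) \<in> r" "d \<noteq> c" using no ca(1) by blast
  have "Some (c, a) \<in> upper_block d"
    using critical_pair_in_upper_block[OF crit xy(3) d(1)] ca(2) by blast
  then have "(d, c) \<in> r" by (simp add: upper_block_iff)
  then show False using chain_order(2) d(2,3) by blast
qed

text \<open>
  An unseparated pair of components bounds an interval of equal two-element components. The block of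
  this interval meets the block of the up-set of \<open>d2\<close> in a single element, so the two congruences
  have no pair of distinct elements in common.
\<close>

lemma separated_if_critical_pair:
  assumes "has_critical_pair nsum"
  shows "separated C r M"
  unfolding separated_def
proof (intro ballI impI, rule ccontr)
  fix d1 d2 assume d: "d1 \<in> C" "d2 \<in> C"
    and eq: "(d1, d2) \<in> r \<and> d1 \<noteq> d2 \<and> M d1 = M d2 \<and> M d1 \<in> {C2, C2d}"
    and no: "\<not> (\<exists>b\<in>C. (d1, b) \<in> r \<and> d1 \<noteq> b \<and> (b, d2) \<in> r \<and> b \<noteq> d2 \<and> M b \<noteq> M d1)"
  obtain x y where xy: "x \<noteq> y"
    and crit: "\<And>\<theta>. congruence nsum \<theta> \<Longrightarrow> \<theta> \<noteq> Id_on (carrier nsum) \<Longrightarrow> (x, y) \<in> \<theta>"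
    using assms unfolding has_critical_pair_def by blast
  have "M d1 = pure_component Bot \<or> M d1 = pure_component Top"
    using eq by (auto simp: pure_component_def)
  then obtain a where a: "a \<noteq> E" "M d1 = pure_component a" by blast
  have pure: "M k = pure_component a" if k: "(d1, k) \<in> r" "(k, d2) \<in> r" for k
  proof -
    have "M k = M d1" using no k eq chain_order(5)[OF k(1)] by metis
    then show ?thesis using a(2) by simp
  qed
  let ?X = "interval_block a d1 d2"
  have "Some (d1, a) \<in> ?X" "Some (d2, a) \<in> ?X"
    using eq d chain_order(1) by (auto simp: interval_block_def)
  then have "(Some (d1, a), Some (d2, a)) \<in> block_relation (carrier nsum) ?X"
    by (simp add: block_relation_def)
  moreover have "(Some (d1, a), Some (d2, a)) \<notin> Id_on (carrier nsum)" using eq by auto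
  ultimately have nontrivial: "block_relation (carrier nsum) ?X \<noteq> Id_on (carrier nsum)" by metis
  have "congruence nsum (block_relation (carrier nsum) ?X)"
    using a(1) pure by (rule congruence_interval_block)
  then have "(x, y) \<in> block_relation (carrier nsum) ?X" using nontrivial by (rule crit)
  then have X: "x \<in> ?X" "y \<in> ?X" using xy by (auto simp: block_relation_def)
  have only: "z = Some (d2, a)" if "z \<in> ?X" "z \<in> upper_block d2" for z
    using that chain_order(2) by (auto simp: interval_block_def upper_block_iff)
  have "x = Some (d2, a)" "y = Some (d2, a)"
    using only X critical_pair_in_upper_block[OF crit xy d(2)] by blast+
  then show False using xy by simp
qed

text \<open>
  A nontrivial congruence collapses some non-identity element, hence also the maximal component,
  which lies above it.
\<close>

lemma atom_if_separated:
  assumes sep: "separated C r M" and m: "m \<in> C" "\<forall>c\<in>C. (m, c) \<in> r \<longrightarrow> c = m"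
  shows "atom_of (Con nsum) (block_relation (carrier nsum) (upper_block m))"
proof -
  let ?Id = "Id_on (carrier nsum)" and ?\<alpha> = "block_relation (carrier nsum) (upper_block m)"
  have \<alpha>: "?\<alpha> \<in> Con nsum" using congruence_upper_block by (simp add: Con_def)
  have Id: "?Id \<in> Con nsum" using congruence_Id_on[OF N.om_closed] by (simp add: Con_def)
  have least: "?Id \<subseteq> \<gamma>" if "\<gamma> \<in> Con nsum" for \<gamma>
    using Id_on_subset_congruence[of nsum \<gamma>] that by (simp add: Con_def)
  have "?\<alpha> \<subseteq> \<gamma>" if \<gamma>: "\<gamma> \<in> Con nsum" "?Id \<noteq> \<gamma>" for \<gamma>
  proof -
    have cong: "congruence nsum \<gamma>" using \<gamma>(1) by (simp add: Con_def)
    obtain u v where uv: "(u, v) \<in> \<gamma>" "u \<noteq> v"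
      using nontrivial_congruence[OF cong] \<gamma>(2) by metis
    have "(u, None) \<in> \<gamma>" "(v, None) \<in> \<gamma>"
      using separated_related_to_unit[OF sep cong] uv congruenceD(2)[OF cong uv(1)] by auto
    then obtain c a where ca: "(Some (c, a), None) \<in> \<gamma>"
      using uv(2) by (cases u; cases v) auto
    then have "c \<in> C" using congruenceD(4)[OF cong ca] by simp
    then have cm: "(c, m) \<in> r" using chain_order(1,4) m by metis
    have K: "(z, None) \<in> \<gamma>" if "z \<in> upper_block m" for z
    proof (cases z)
      case None
      then show ?thesis using congruenceD(1)[OF cong] by simp
    next
      case (Some p)
      obtain k b where "p = (k, b)" by fastforce
      then have z: "z = Some (k, b)" using Some by simp
      then have "k = m" using that m chain_order(5) by (auto simp: upper_block_iff)
      then show ?thesis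
        using unit_class_up_closed[OF cong ca cm] that z by (simp add: upper_block_iff)
    qed
    show ?thesis
    proof (rule subrelI)
      fix u v assume "(u, v) \<in> ?\<alpha>"
      then have "u \<in> carrier nsum \<and> u = v \<or> (u, None) \<in> \<gamma> \<and> (v, None) \<in> \<gamma>"
        using K by (auto simp: block_relation_def)
      then show "(u, v) \<in> \<gamma>" by (rule iffD2[OF separated_related_iff[OF sep cong]])
    qed
  qed
  then have "\<not> (\<exists>\<gamma>\<in>Con nsum. ?Id \<subset> \<gamma> \<and> \<gamma> \<subset> ?\<alpha>)" by (metis psubset_eq subset_antisym)
  moreover have "?Id \<subset> ?\<alpha>" using least[OF \<alpha>] upper_block_nontrivial[OF m(1)] by (metis psubset_eq)
  ultimately show ?thesis
    unfolding atom_of_def using \<alpha> least by (intro conjI bexI[OF _ Id] ballI) simp_all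
qed

end

theorem theorem4p6:
  fixes C :: "'c set" and r :: "'c rel" and M :: "'c \<Rightarrow> elt om_algebra"
  assumes "linear_order_on C r"
    and "\<And>c. c \<in> C \<Longrightarrow> M c \<in> {C2, C2d, G3, D3}"
  shows "(subdirectly_irreducible (nested_sum C r M) \<longleftrightarrow>
            (\<exists>m\<in>C. \<forall>c\<in>C. (m, c) \<in> r \<longrightarrow> c = m) \<and>
            (\<forall>d1\<in>C. \<forall>d2\<in>C.
               (d1, d2) \<in> r \<and> d1 \<noteq> d2 \<and> M d1 = M d2 \<and> M d1 \<in> {C2, C2d} \<longrightarrow>
               (\<exists>b\<in>C. (d1, b) \<in> r \<and> d1 \<noteq> b \<and> (b, d2) \<in> r \<and> b \<noteq> d2 \<and> M b \<noteq> M d1)))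
       \<and> (subdirectly_irreducible (nested_sum C r M) \<longleftrightarrow>
            chain\<^sub>\<subseteq> (Con (nested_sum C r M)) \<and>
            (\<exists>\<alpha>. atom_of (Con (nested_sum C r M)) \<alpha>))"
proof -
  let ?N = "nested_sum C r M"
  let ?max = "\<exists>m\<in>C. \<forall>c\<in>C. (m, c) \<in> r \<longrightarrow> c = m"
  have cl: "om_closed ?N"
    using idempotent_ordered_monoid_nsum[where M = M, OF assms] by (rule idempotent_ordered_monoid.om_closed)
  have si: "subdirectly_irreducible ?N \<longleftrightarrow> has_critical_pair ?N"
    using critical_pair_if_subdirectly_irreducible[OF cl]
      subdirectly_irreducible_if_critical_pair[OF cl] by blast
  have "has_critical_pair ?N \<Longrightarrow> ?max \<and> separated C r M"
    using maximal_if_critical_pair[where M = M, OF assms] separated_if_critical_pair[where M = M, OF assms] by blast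
  moreover have "?max \<and> separated C r M \<Longrightarrow> chain\<^sub>\<subseteq> (Con ?N) \<and> (\<exists>\<alpha>. atom_of (Con ?N) \<alpha>)"
    using chain_congruences_if_separated[where M = M, OF assms] atom_if_separated[where M = M, OF assms] by blast
  moreover have "chain\<^sub>\<subseteq> (Con ?N) \<and> (\<exists>\<alpha>. atom_of (Con ?N) \<alpha>) \<Longrightarrow> has_critical_pair ?N"
    using critical_pair_if_chain_with_atom[OF cl] by blast
  ultimately have "(has_critical_pair ?N \<longleftrightarrow> ?max \<and> separated C r M) \<and>
      (has_critical_pair ?N \<longleftrightarrow> chain\<^sub>\<subseteq> (Con ?N) \<and> (\<exists>\<alpha>. atom_of (Con ?N) \<alpha>))"
    by blast
  then show ?thesis unfolding si separated_def .
qed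

end
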